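(* For every integer $d\ge2$, the set $\eta(\mathcal O_d)$ is a semialgebraic subset of $\mathbb R^{3d}$; consequently $\mathcal O_d$ has only finitely many path components.
   Context: A polynomial knot is a map $\phi:\mathbb R\to\mathbb R^3$ with real polynomial components which is a smooth embedding ($\phi$ injective and $\phi'(t)\ne0$ for all $t$). For $d\ge2$, $\mathcal A_d$ is the set of polynomial maps $t\mapsto(f(t),g(t),h(t))$ with $\deg f\le d-2$, $\deg g\le d-1$, $\deg h\le d$, and $\eta:\mathcal A_d\to\mathbb R^{3d}$ is the bijection $(f,g,h)\mapsto(a_0,\dots,a_{d-2},b_0,\dots,b_{d-1},c_0,\dots,c_d)$, where $f=\sum a_it^i$, $g=\sum b_it^i$, $h=\sum c_it^i$; $\mathcal A_d$ carries the topology making $\eta$ a homeomorphism onto Euclidean $\mathbb R^{3d}$. $\mathcal O_d$ is the subspace of polynomial knots in $\mathcal A_d$. A subset of $\mathbb R^n$ is semialgebraic if it belongs to the smallest class of subsets containing all sets $\{P=0\}$ and $\{P>0\}$ for real polynomials $P$ in $n$ variables and closed under finite unions, finite intersections and complements. *)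

theory Defs
  imports "HOL-Analysis.Analysis" "HOL-Computational_Algebra.Polynomial"
begin

text \<open>Euclidean space R^n, modelled as the functions nat => real vanishing at all
  indices >= n (coordinates 0,...,n-1). The product topology on nat => real restricted
  to this set is the Euclidean topology.\<close>
definition Rn :: "nat \<Rightarrow> (nat \<Rightarrow> real) set" where
  "Rn n = {x. \<forall>i\<ge>n. x i = 0}"

inductive poly_fun :: "nat \<Rightarrow> ((nat \<Rightarrow> real) \<Rightarrow> real) \<Rightarrow> bool" for n where
  pf_const: "poly_fun n (\<lambda>x. c)"
| pf_var: "i < n \<Longrightarrow> poly_fun n (\<lambda>x. x i)"
| pf_add: "poly_fun n p \<Longrightarrow> poly_fun n q \<Longrightarrow> poly_fun n (\<lambda>x. p x + q x)"
| pf_mult: "poly_fun n p \<Longrightarrow> poly_fun n q \<Longrightarrow> poly_fun n (\<lambda>x. p x * q x)"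

inductive semialgebraic :: "nat \<Rightarrow> (nat \<Rightarrow> real) set \<Rightarrow> bool" for n where
  sa_zero: "poly_fun n p \<Longrightarrow> semialgebraic n {x \<in> Rn n. p x = 0}"
| sa_pos: "poly_fun n p \<Longrightarrow> semialgebraic n {x \<in> Rn n. p x > 0}"
| sa_union: "semialgebraic n A \<Longrightarrow> semialgebraic n B \<Longrightarrow> semialgebraic n (A \<union> B)"
| sa_inter: "semialgebraic n A \<Longrightarrow> semialgebraic n B \<Longrightarrow> semialgebraic n (A \<inter> B)"
| sa_compl: "semialgebraic n A \<Longrightarrow> semialgebraic n (Rn n - A)"

definition A_d :: "nat \<Rightarrow> (real poly \<times> real poly \<times> real poly) set" where
  "A_d d = {(f, g, h). degree f \<le> d - 2 \<and> degree g \<le> d - 1 \<and> degree h \<le> d}"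

definition eta :: "nat \<Rightarrow> real poly \<times> real poly \<times> real poly \<Rightarrow> (nat \<Rightarrow> real)" where
  "eta d = (\<lambda>(f, g, h) i.
     if i < d - 1 then coeff f i
     else if i < 2 * d - 1 then coeff g (i - (d - 1))
     else if i < 3 * d then coeff h (i - (2 * d - 1))
     else 0)"

text \<open>Topology on A_d making eta a homeomorphism onto Euclidean R^{3d}.\<close>
definition A_d_topology :: "nat \<Rightarrow> (real poly \<times> real poly \<times> real poly) topology" where
  "A_d_topology d = pullback_topology (A_d d) (eta d) (subtopology euclidean (Rn (3 * d)))"

definition polynomial_knot :: "real poly \<times> real poly \<times> real poly \<Rightarrow> bool" where
  "polynomial_knot = (\<lambda>(f, g, h).
     inj (\<lambda>t. (poly f t, poly g t, poly h t)) \<and>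
     (\<forall>t. (poly (pderiv f) t, poly (pderiv g) t, poly (pderiv h) t) \<noteq> (0, 0, 0)))"

definition O_d :: "nat \<Rightarrow> (real poly \<times> real poly \<times> real poly) set" where
  "O_d d = {\<phi> \<in> A_d d. polynomial_knot \<phi>}"

end

theory Submission
  imports Defs
begin

text \<open>
  Cohen-Hoermander sign diagrams: for finitely many polynomials \<open>f x\<close> in one variable whose
  coefficients are polynomials in \<open>x\<close>, the ordered list of their real roots, and their signs on the
  roots and on the gaps, depend only on the signs of finitely many polynomials in \<open>x\<close>. Indeed, remove
  an \<open>f\<close> of maximal degree and put in its derivative and its (pseudo-)remainders by the other members.
  The remainders give the sign of \<open>f\<close> at the roots already present, and by Rolle's theorem each gap
  contains at most one root of \<open>f\<close>, detected by a sign change. Since \<open>f\<close> changes sign at that root,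
  the root depends continuously on \<open>x\<close>.

  So a sign diagram over a path-connected set cuts the cylinder over it into path-connected graphs and
  bands, and induction on the dimension partitions \<open>R^n\<close> into finitely many path-connected
  sets on which given polynomials have constant signs. Over a sign class of the base, which
  cells meet a fibre is constant, hence projections of semialgebraic sets are semialgebraic. Being
  a knot is a first-order condition on the coefficients with two real quantifiers.
\<close>

section \<open>Graphs, bands and sign diagrams\<close>

text \<open>The two applications pull in different directions. Path components need continuous
  sections over path-connected cells, while the projection theorem compares two parameter points
  that need not be joined by a path inside their sign class. Hence the induction speaks of every
  base set \<open>A\<close> on which the chosen polynomials have constant signs, connected or not.
  Roots therefore cannot be followed along paths: they are matched between fibres by the cell that
  contains them, and continuity is proved afterwards.

  The induction terminates although remainders multiply the members: a step removes one member of
  top formal degree and adds only members of lower formal degree. Degrees are formal because the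
  actual degree varies with the parameter. Where the top coefficient of the chosen member vanishes
  it is cut off; where it does not, the prescribed signs of all coefficients also make the actual
  degree of each divisor constant.\<close>

lemma ex_max_on_finite:
  fixes g :: "'a \<Rightarrow> real"
  assumes "finite S" "S \<noteq> {}"
  shows "\<exists>l\<in>S. \<forall>k\<in>S. g k \<le> g l"
proof -
  have "Max (g ` S) \<in> g ` S" using assms by simp
  then obtain l where "l \<in> S" "g l = Max (g ` S)" by force
  then show ?thesis using assms by (metis Max_ge finite_imageI imageI)
qed

lemma ex_min_on_finite:
  fixes g :: "'a \<Rightarrow> real"
  assumes "finite S" "S \<noteq> {}"
  shows "\<exists>l\<in>S. \<forall>k\<in>S. g l \<le> g k"
  using ex_max_on_finite[OF assms, of "\<lambda>x. - g x"] by auto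

text \<open>At a zero \<open>l\<close> the mean value theorem gives \<open>p\<close> the sign of its
  derivative just to the right; at a nonzero value continuity keeps the sign. So the sign at the
  lower end of a gap is read off from its lower boundary point.\<close>

lemma sgn_poly_at_right_end:
  fixes p :: "real poly"
  assumes "l < u" and e: "\<And>t. l < t \<Longrightarrow> t \<le> u \<Longrightarrow> sgn (poly (pderiv p) t) = e"
  shows "\<exists>t. l < t \<and> t < u \<and> sgn (poly p t) = (if poly p l = 0 then e else sgn (poly p l))"
proof (cases "poly p l = 0")
  case True
  define t where "t = (l + u) / 2"
  have t: "l < t" "t < u" using \<open>l < u\<close> by (auto simp: t_def)
  obtain c where c: "l < c" "c < t" "poly p t - poly p l = (t - l) * poly (pderiv p) c"
    using poly_MVT[OF t(1)] by blast
  then have "sgn (poly p t) = e" using True t e[of c] by (simp add: sgn_mult)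
  then show ?thesis using t True by auto
next
  case False
  have "(poly p \<longlongrightarrow> poly p l) (at_right l)"
    by (intro tendsto_intros)
  then have "((\<lambda>t. sgn (poly p t)) \<longlongrightarrow> sgn (poly p l)) (at_right l)"
    using False by (intro tendsto_intros) auto
  \<comment> \<open>Distinct values of \<open>sgn\<close> are at distance at least 1, so this
    closeness is equality.\<close>
  then have "\<forall>\<^sub>F t in at_right l. dist (sgn (poly p t)) (sgn (poly p l)) < 1"
    by (simp add: tendstoD)
  moreover have "\<forall>\<^sub>F t in at_right l. l < t \<and> t < u"
    using \<open>l < u\<close> by (auto simp: eventually_at_right intro: exI[of _ u])
  ultimately have "\<forall>\<^sub>F t in at_right l. l < t \<and> t < u \<and> sgn (poly p t) = sgn (poly p l)"
    by eventually_elim (auto simp: sgn_if dist_real_def split: if_splits)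
  then show ?thesis using False
    by (auto dest!: eventually_happens simp: trivial_limit_at_right_real)
qed

text \<open>Reflection through 0 reduces this to a right neighbourhood; the chain rule turns
  \<open>e\<close> into \<open>- e\<close>.\<close>

lemma sgn_poly_at_left_end:
  fixes p :: "real poly"
  assumes "u < r" and e: "\<And>t. u \<le> t \<Longrightarrow> t < r \<Longrightarrow> sgn (poly (pderiv p) t) = e"
  shows "\<exists>t. u < t \<and> t < r \<and> sgn (poly p t) = (if poly p r = 0 then - e else sgn (poly p r))"
proof -
  have "\<exists>t. - r < t \<and> t < - u \<and> sgn (poly (pcompose p [:0, -1:]) t) =
      (if poly (pcompose p [:0, -1:]) (- r) = 0 then - e else sgn (poly (pcompose p [:0, -1:]) (- r)))"
    by (rule sgn_poly_at_right_end)
      (use assms in \<open>auto simp: pderiv_pcompose poly_pcompose pderiv_pCons sgn_minus\<close>)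
  then obtain t where "- r < t" "t < - u"
    "sgn (poly p (- t)) = (if poly p r = 0 then - e else sgn (poly p r))"
    by (auto simp: poly_pcompose split: if_splits)
  then show ?thesis by (intro exI[of _ "- t"]) auto
qed

lemma sgn_poly_at_top:
  fixes p :: "real poly"
  assumes "p \<noteq> 0"
  shows "\<exists>B. \<forall>t\<ge>B. sgn (poly p t) = sgn (lead_coeff p)"
proof (cases "lead_coeff p > 0")
  case True
  then obtain n where "\<forall>x\<ge>n. poly p x \<ge> lead_coeff p" using poly_pinfty_gt_lc by blast
  then show ?thesis using True by (intro exI[of _ n]) force
next
  case False
  then have neg: "lead_coeff p < 0" using assms by (meson leading_coeff_0_iff linorder_neqE)
  then have "lead_coeff (- p) > 0" by simp
  then obtain n where "\<forall>x\<ge>n. poly (- p) x \<ge> lead_coeff (- p)" using poly_pinfty_gt_lc by blast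
  then show ?thesis using neg by (intro exI[of _ n]) force
qed

lemma sgn_poly_at_bot:
  fixes p :: "real poly"
  assumes "p \<noteq> 0"
  shows "\<exists>B. \<forall>t\<le>B. sgn (poly p t) = sgn (lead_coeff p) * (- 1) ^ degree p"
proof -
  have lc: "lead_coeff (pcompose p [:0, -1:]) = lead_coeff p * (- 1) ^ degree p"
    by (subst lead_coeff_comp) auto
  then have "pcompose p [:0, -1:] \<noteq> 0" using assms by auto
  from sgn_poly_at_top[OF this] obtain B where
    B: "\<forall>t\<ge>B. sgn (poly p (- t)) = sgn (lead_coeff p * (- 1) ^ degree p)"
    unfolding lc by (auto simp: poly_pcompose)
  then have "sgn (poly p t) = sgn (lead_coeff p) * (- 1) ^ degree p" if "t \<le> - B" for t
    using that B[rule_format, of "- t"] by (simp add: sgn_mult power_sgn[symmetric])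
  then show ?thesis by blast
qed

section \<open>Cells over a base set and continuous choices of points in them\<close>

text \<open>A finite set \<open>\<Xi>\<close> of functions that are strictly ordered or equal over \<open>A\<close> cuts the cylinder over
  \<open>A\<close> into graphs and bands. Instead of numbering them, a cell is described by the signs of
  \<open>t - \<xi> x\<close> for \<open>\<xi> \<in> \<Xi>\<close>.\<close>

definition same_cell :: "('a \<Rightarrow> real) set \<Rightarrow> 'a \<Rightarrow> real \<Rightarrow> 'a \<Rightarrow> real \<Rightarrow> bool" where
  "same_cell \<Xi> x s y t \<longleftrightarrow> (\<forall>\<xi>\<in>\<Xi>. sgn (s - \<xi> x) = sgn (t - \<xi> y))"

text \<open>Because both the pair and the two points may be exchanged, this one implication also
  carries equality over \<open>x\<close> to equality over \<open>y\<close>.\<close>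

definition ordered_sections :: "'a::topological_space set \<Rightarrow> ('a \<Rightarrow> real) set \<Rightarrow> bool" where
  "ordered_sections A \<Xi> \<longleftrightarrow> finite \<Xi> \<and> (\<forall>\<xi>\<in>\<Xi>. continuous_on A \<xi>) \<and>
     (\<forall>\<xi>\<in>\<Xi>. \<forall>\<eta>\<in>\<Xi>. \<forall>x\<in>A. \<forall>y\<in>A. \<xi> x < \<eta> x \<longrightarrow> \<xi> y < \<eta> y)"

lemma same_cell_sym: "same_cell \<Xi> x s y t \<Longrightarrow> same_cell \<Xi> y t x s"
  by (simp add: same_cell_def)

lemma same_cell_trans: "same_cell \<Xi> x s y t \<Longrightarrow> same_cell \<Xi> y t z u \<Longrightarrow> same_cell \<Xi> x s z u"
  by (simp add: same_cell_def)

lemma same_cell_mono: "same_cell \<Xi> x s y t \<Longrightarrow> \<Xi>' \<subseteq> \<Xi> \<Longrightarrow> same_cell \<Xi>' x s y t"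
  by (auto simp: same_cell_def)

lemma same_cell_convex:
  assumes "same_cell \<Xi> x s y a" "same_cell \<Xi> x s y b" "a \<le> t" "t \<le> b"
  shows "same_cell \<Xi> x s y t"
  unfolding same_cell_def
proof
  fix \<xi> assume "\<xi> \<in> \<Xi>"
  then have "sgn (s - \<xi> x) = sgn (a - \<xi> y)" "sgn (s - \<xi> x) = sgn (b - \<xi> y)"
    using assms by (auto simp: same_cell_def)
  then show "sgn (s - \<xi> x) = sgn (t - \<xi> y)"
    using assms(3,4) by (auto simp: sgn_if split: if_splits)
qed

lemma same_cell_section_iff:
  assumes "same_cell \<Xi> x s y t" "\<xi> \<in> \<Xi>"
  shows "s = \<xi> x \<longleftrightarrow> t = \<xi> y" "s < \<xi> x \<longleftrightarrow> t < \<xi> y" "\<xi> x < s \<longleftrightarrow> \<xi> y < t"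
proof -
  have *: "sgn (s - \<xi> x) = sgn (t - \<xi> y)" using assms by (auto simp: same_cell_def)
  show "s = \<xi> x \<longleftrightarrow> t = \<xi> y" "s < \<xi> x \<longleftrightarrow> t < \<xi> y" "\<xi> x < s \<longleftrightarrow> \<xi> y < t"
    using * by (auto simp: sgn_if split: if_splits)
qed

lemma same_cellI:
  assumes "\<And>\<xi>. \<xi> \<in> \<Xi> \<Longrightarrow> s < \<xi> x \<Longrightarrow> t < \<xi> y" "\<And>\<xi>. \<xi> \<in> \<Xi> \<Longrightarrow> \<xi> x < s \<Longrightarrow> \<xi> y < t"
    "\<And>\<xi>. \<xi> \<in> \<Xi> \<Longrightarrow> s = \<xi> x \<Longrightarrow> t = \<xi> y"
  shows "same_cell \<Xi> x s y t"
  unfolding same_cell_def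
proof
  fix \<xi> assume "\<xi> \<in> \<Xi>"
  then show "sgn (s - \<xi> x) = sgn (t - \<xi> y)"
    using assms[of \<xi>] by (cases s "\<xi> x" rule: linorder_cases) (auto simp: sgn_if)
qed

lemma ordered_sections_le:
  assumes "ordered_sections A \<Xi>" "\<xi> \<in> \<Xi>" "\<eta> \<in> \<Xi>" "x \<in> A" "y \<in> A" "\<xi> x \<le> \<eta> x"
  shows "\<xi> y \<le> \<eta> y"
proof (rule ccontr)
  assume "\<not> \<xi> y \<le> \<eta> y"
  then have "\<eta> y < \<xi> y" by simp
  moreover have "\<eta> y < \<xi> y \<longrightarrow> \<eta> x < \<xi> x"
    using assms(1-5) unfolding ordered_sections_def by blast
  ultimately have "\<eta> x < \<xi> x" by blast
  then show False using assms(6) by simp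
qed

lemma section_same_cell:
  assumes os: "ordered_sections A \<Xi>" and \<xi>: "\<xi> \<in> \<Xi>" and x0: "x0 \<in> A" and x: "x \<in> A"
  shows "same_cell \<Xi> x0 (\<xi> x0) x (\<xi> x)"
proof (rule same_cellI)
  have lt: "\<eta> x < \<theta> x" if "\<eta> \<in> \<Xi>" "\<theta> \<in> \<Xi>" "\<eta> x0 < \<theta> x0" for \<eta> \<theta>
    using os that x0 x unfolding ordered_sections_def by blast
  fix \<eta> assume \<eta>: "\<eta> \<in> \<Xi>"
  show "\<xi> x0 < \<eta> x0 \<Longrightarrow> \<xi> x < \<eta> x" by (rule lt[OF \<xi> \<eta>])
  show "\<eta> x0 < \<xi> x0 \<Longrightarrow> \<eta> x < \<xi> x" by (rule lt[OF \<eta> \<xi>])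
  show "\<xi> x0 = \<eta> x0 \<Longrightarrow> \<xi> x = \<eta> x"
    using ordered_sections_le[OF os \<eta> \<xi> x0 x] ordered_sections_le[OF os \<xi> \<eta> x0 x] by simp
qed

text \<open>A graph is its own selection. In a band, the nearest section below and the nearest above
  over \<open>x0\<close> remain nearest over all of \<open>A\<close>, so their midpoint, or a shift
  by 1 when one of them is absent, stays inside.\<close>

lemma cell_section:
  fixes A :: "'a::topological_space set"
  assumes os: "ordered_sections A \<Xi>" and x0: "x0 \<in> A"
  shows "\<exists>m. continuous_on A m \<and> (\<forall>x\<in>A. same_cell \<Xi> x0 s x (m x))"
proof (cases "\<exists>\<xi>\<in>\<Xi>. s = \<xi> x0")
  case True
  then obtain \<xi> where \<xi>: "\<xi> \<in> \<Xi>" "s = \<xi> x0" by blast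
  have "same_cell \<Xi> x0 s x (\<xi> x)" if "x \<in> A" for x
    using section_same_cell[OF os \<xi>(1) x0 that] \<xi>(2) by simp
  moreover have "continuous_on A \<xi>" using os \<xi> by (auto simp: ordered_sections_def)
  ultimately show ?thesis by (intro exI[of _ \<xi>]) simp
next
  case False
  have fin: "finite \<Xi>" and cont: "\<And>\<xi>. \<xi> \<in> \<Xi> \<Longrightarrow> continuous_on A \<xi>"
    and ord: "\<And>\<xi> \<eta> x. \<xi> \<in> \<Xi> \<Longrightarrow> \<eta> \<in> \<Xi> \<Longrightarrow> x \<in> A \<Longrightarrow> \<xi> x0 < \<eta> x0 \<Longrightarrow> \<xi> x < \<eta> x"
    using os x0 by (auto simp: ordered_sections_def)
  define L where "L = {\<xi>\<in>\<Xi>. \<xi> x0 < s}"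
  define U where "U = {\<xi>\<in>\<Xi>. s < \<xi> x0}"
  have LU: "\<xi> x < \<eta> x" if "\<xi> \<in> L" "\<eta> \<in> U" "x \<in> A" for \<xi> \<eta> x
    using that ord[of \<xi> \<eta> x] by (auto simp: L_def U_def)
  have *: "\<exists>m. continuous_on A m \<and> (\<forall>x\<in>A. (\<forall>\<xi>\<in>L. \<xi> x < m x) \<and> (\<forall>\<xi>\<in>U. m x < \<xi> x))"
  proof -
    have finL: "finite L" and finU: "finite U" using fin by (auto simp: L_def U_def)
    have l: "\<exists>l\<in>L. \<forall>x\<in>A. \<forall>\<xi>\<in>L. \<xi> x \<le> l x" if "L \<noteq> {}"
    proof -
      obtain l where "l \<in> L" "\<forall>\<xi>\<in>L. \<xi> x0 \<le> l x0"
        by (rule bexE[OF ex_max_on_finite[OF finL \<open>L \<noteq> {}\<close>, of "\<lambda>\<xi>. \<xi> x0"]])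
      moreover have "\<xi> x \<le> l x" if "x \<in> A" "\<xi> \<in> L" "l \<in> L" "\<xi> x0 \<le> l x0" for x \<xi>
        using ordered_sections_le[OF os, of \<xi> l x0 x] that x0 by (simp add: L_def)
      ultimately show ?thesis by (intro bexI[of _ l]) simp_all
    qed
    have u: "\<exists>u\<in>U. \<forall>x\<in>A. \<forall>\<xi>\<in>U. u x \<le> \<xi> x" if "U \<noteq> {}"
    proof -
      obtain u where "u \<in> U" "\<forall>\<xi>\<in>U. u x0 \<le> \<xi> x0"
        by (rule bexE[OF ex_min_on_finite[OF finU \<open>U \<noteq> {}\<close>, of "\<lambda>\<xi>. \<xi> x0"]])
      moreover have "u x \<le> \<xi> x" if "x \<in> A" "\<xi> \<in> U" "u \<in> U" "u x0 \<le> \<xi> x0" for x \<xi>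
        using ordered_sections_le[OF os, of u \<xi> x0 x] that x0 by (simp add: U_def)
      ultimately show ?thesis by (intro bexI[of _ u]) simp_all
    qed
    have contL: "continuous_on A l" if "l \<in> L" for l using that cont by (auto simp: L_def)
    have contU: "continuous_on A l" if "l \<in> U" for l using that cont by (auto simp: U_def)
    consider "L = {}" "U = {}" | "L \<noteq> {}" "U = {}" | "L = {}" "U \<noteq> {}" | "L \<noteq> {}" "U \<noteq> {}"
      by blast
    then show ?thesis
    proof cases
      case 1 then show ?thesis by (intro exI[of _ "\<lambda>_. 0"]) auto
    next
      case 2
      then obtain l where "l \<in> L" "\<forall>x\<in>A. \<forall>\<xi>\<in>L. \<xi> x \<le> l x" using l by blast
      then have "\<forall>x\<in>A. \<forall>\<xi>\<in>L. \<xi> x < l x + 1" by (meson le_less_trans less_add_one)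
      then show ?thesis using 2 contL[OF \<open>l \<in> L\<close>]
        by (intro exI[of _ "\<lambda>x. l x + 1"]) (simp add: continuous_on_add)
    next
      case 3
      then obtain u where "u \<in> U" "\<forall>x\<in>A. \<forall>\<xi>\<in>U. u x \<le> \<xi> x" using u by blast
      have "u x - 1 < \<xi> x" if "x \<in> A" "\<xi> \<in> U" for x \<xi>
        using \<open>\<forall>x\<in>A. \<forall>\<xi>\<in>U. u x \<le> \<xi> x\<close>[rule_format, OF that] by linarith
      then show ?thesis using 3 contU[OF \<open>u \<in> U\<close>]
        by (intro exI[of _ "\<lambda>x. u x - 1"]) (simp add: continuous_on_diff)
    next
      case 4
      obtain l where l: "l \<in> L" "\<forall>x\<in>A. \<forall>\<xi>\<in>L. \<xi> x \<le> l x" by (rule bexE[OF l[OF 4(1)]])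
      obtain u where u: "u \<in> U" "\<forall>x\<in>A. \<forall>\<xi>\<in>U. u x \<le> \<xi> x" by (rule bexE[OF u[OF 4(2)]])
      have "l x < (l x + u x) / 2" "(l x + u x) / 2 < u x" if "x \<in> A" for x
        using LU[OF l(1) u(1) that] by auto
      then have "\<xi> x < (l x + u x) / 2" if "x \<in> A" "\<xi> \<in> L" for x \<xi>
        using l(2)[rule_format, OF that] that by (meson le_less_trans)
      moreover have "(l x + u x) / 2 < \<xi> x" if "x \<in> A" "\<xi> \<in> U" for x \<xi>
        using u(2)[rule_format, OF that] \<open>\<And>x. x \<in> A \<Longrightarrow> (l x + u x) / 2 < u x\<close> that by (meson less_le_trans)
      moreover have "continuous_on A (\<lambda>x. (l x + u x) / 2)"
        using contL[OF l(1)] contU[OF u(1)] by (intro continuous_intros) auto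
      ultimately show ?thesis by (intro exI[of _ "\<lambda>x. (l x + u x) / 2"]) simp
    qed
  qed
  then obtain m where m: "continuous_on A m" "\<forall>x\<in>A. (\<forall>\<xi>\<in>L. \<xi> x < m x) \<and> (\<forall>\<xi>\<in>U. m x < \<xi> x)"
    by blast
  have "same_cell \<Xi> x0 s x (m x)" if "x \<in> A" for x
    using m(2) that False by (intro same_cellI) (auto simp: L_def U_def)
  then show ?thesis using m(1) by (intro exI[of _ m]) simp
qed

text \<open>No cell disappears between fibres; this is what moves the witness of an existential
  quantifier to another parameter.\<close>

lemma cell_transfer:
  assumes "ordered_sections A \<Xi>" "x \<in> A" "y \<in> A"
  shows "\<exists>t. same_cell \<Xi> x s y t"
  by (rule exE[OF cell_section[OF assms(1,2), of s]]) (use assms(3) in blast)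

text \<open>A member may be the zero polynomial throughout \<open>A\<close>; it then contributes no
  sections. Each section must be a root of some nonzero member, because reduction modulo that member
  is how the sign of a further polynomial on the section is found.\<close>

definition sign_diagram ::
    "'a::topological_space set \<Rightarrow> ('a \<Rightarrow> real poly) set \<Rightarrow> ('a \<Rightarrow> real) set \<Rightarrow> bool" where
  "sign_diagram A F \<Xi> \<longleftrightarrow> ordered_sections A \<Xi> \<and>
     (\<forall>f\<in>F. (\<forall>x\<in>A. f x = 0) \<or>
        (\<forall>x\<in>A. f x \<noteq> 0 \<and> (\<forall>t. poly (f x) t = 0 \<longrightarrow> (\<exists>\<xi>\<in>\<Xi>. t = \<xi> x)))) \<and>
     (\<forall>\<xi>\<in>\<Xi>. \<exists>f\<in>F. \<forall>x\<in>A. f x \<noteq> 0 \<and> poly (f x) (\<xi> x) = 0) \<and>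
     (\<forall>f\<in>F. \<forall>x\<in>A. \<forall>y\<in>A. \<forall>s t. same_cell \<Xi> x s y t \<longrightarrow>
        sgn (poly (f x) s) = sgn (poly (f y) t))"

lemma sign_diagramI:
  assumes "ordered_sections A \<Xi>"
    and "\<And>f. f \<in> F \<Longrightarrow> (\<forall>x\<in>A. f x = 0) \<or>
        (\<forall>x\<in>A. f x \<noteq> 0 \<and> (\<forall>t. poly (f x) t = 0 \<longrightarrow> (\<exists>\<xi>\<in>\<Xi>. t = \<xi> x)))"
    and "\<And>\<xi>. \<xi> \<in> \<Xi> \<Longrightarrow> \<exists>f\<in>F. \<forall>x\<in>A. f x \<noteq> 0 \<and> poly (f x) (\<xi> x) = 0"
    and "\<And>f x y s t. f \<in> F \<Longrightarrow> x \<in> A \<Longrightarrow> y \<in> A \<Longrightarrow> same_cell \<Xi> x s y t \<Longrightarrow>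
        sgn (poly (f x) s) = sgn (poly (f y) t)"
  shows "sign_diagram A F \<Xi>"
  using assms unfolding sign_diagram_def by simp

lemma sign_diagramD:
  assumes "sign_diagram A F \<Xi>"
  shows "ordered_sections A \<Xi>"
    and "f \<in> F \<Longrightarrow> (\<forall>x\<in>A. f x = 0) \<or>
        (\<forall>x\<in>A. f x \<noteq> 0 \<and> (\<forall>t. poly (f x) t = 0 \<longrightarrow> (\<exists>\<xi>\<in>\<Xi>. t = \<xi> x)))"
    and "\<xi> \<in> \<Xi> \<Longrightarrow> \<exists>f\<in>F. \<forall>x\<in>A. f x \<noteq> 0 \<and> poly (f x) (\<xi> x) = 0"
    and "f \<in> F \<Longrightarrow> x \<in> A \<Longrightarrow> y \<in> A \<Longrightarrow> same_cell \<Xi> x s y t \<Longrightarrow>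
        sgn (poly (f x) s) = sgn (poly (f y) t)"
  using assms unfolding sign_diagram_def by simp_all

lemma poly_sgn_change_root:
  fixes p :: "real poly"
  assumes "sgn (poly p a) \<noteq> sgn (poly p b)" "a \<le> b"
  shows "\<exists>r. a \<le> r \<and> r \<le> b \<and> poly p r = 0"
proof (rule ccontr)
  assume *: "\<not> ?thesis"
  then have "poly p a \<noteq> 0" "poly p b \<noteq> 0" "a < b" using assms by (auto simp: order_le_less)
  then have "poly p a * poly p b < 0"
    using assms(1) by (auto simp: sgn_if mult_less_0_iff split: if_splits)
  then show False using poly_IVT[OF \<open>a < b\<close>] * by force
qed

text \<open>Sections that are roots of no remaining member are dropped, which merges cells. A member
  with two signs in a merged cell would have a root between the two points, hence on a kept section,
  but a kept section cannot separate two points of one cell.\<close>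

lemma sign_diagram_subset:
  assumes d: "sign_diagram A F \<Xi>" and sub: "F' \<subseteq> F"
  shows "\<exists>\<Xi>'\<subseteq>\<Xi>. sign_diagram A F' \<Xi>'"
proof -
  note os = sign_diagramD(1)[OF d] and roots = sign_diagramD(2)[OF d] and sg = sign_diagramD(4)[OF d]
  define \<Xi>' where "\<Xi>' = {\<xi>\<in>\<Xi>. \<exists>f\<in>F'. \<forall>x\<in>A. f x \<noteq> 0 \<and> poly (f x) (\<xi> x) = 0}"
  have os': "ordered_sections A \<Xi>'"
    using os by (auto simp: ordered_sections_def \<Xi>'_def)
  have roots': "(\<forall>x\<in>A. f x = 0) \<or>
        (\<forall>x\<in>A. f x \<noteq> 0 \<and> (\<forall>t. poly (f x) t = 0 \<longrightarrow> (\<exists>\<xi>\<in>\<Xi>'. t = \<xi> x)))" if f: "f \<in> F'" for f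
  proof (rule disjCI)
    have fF: "f \<in> F" using f sub by blast
    assume "\<not> (\<forall>x\<in>A. f x \<noteq> 0 \<and> (\<forall>t. poly (f x) t = 0 \<longrightarrow> (\<exists>\<xi>\<in>\<Xi>'. t = \<xi> x)))"
    moreover have "\<exists>\<xi>\<in>\<Xi>'. t = \<xi> x" if nz: "\<forall>x\<in>A. f x \<noteq> 0" and x: "x \<in> A" and 0: "poly (f x) t = 0" for x t
    proof -
      obtain \<xi> where \<xi>: "\<xi> \<in> \<Xi>" "t = \<xi> x" using roots[OF fF] nz x 0 by blast
      \<comment> \<open>Sign constancy along \<open>\<xi>\<close> makes it a root over every
        \<open>y\<close>, so it is among the kept sections.\<close>
      have "poly (f y) (\<xi> y) = 0" if "y \<in> A" for y
      proof -
        obtain u where "same_cell \<Xi> x t y u"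
          using cell_transfer[OF os x \<open>y \<in> A\<close>, of t] by blast
        then have "same_cell \<Xi> x t y (\<xi> y)" using same_cell_section_iff(1)[of \<Xi> x t y u \<xi>] \<xi> by auto
        then show ?thesis using sg[OF fF x that, of t "\<xi> y"] 0 by (simp add: sgn_zero_iff)
      qed
      then show ?thesis using \<xi> nz f by (auto simp: \<Xi>'_def)
    qed
    ultimately show "\<forall>x\<in>A. f x = 0" using roots[OF fF] by blast
  qed
  have sg': "sgn (poly (f x) s) = sgn (poly (f y) t)"
    if f: "f \<in> F'" and x: "x \<in> A" and y: "y \<in> A" and c: "same_cell \<Xi>' x s y t" for f x y s t
  proof -
    \<comment> \<open>The point \<open>s\<close> is first moved into the fibre over \<open>y\<close>
      through the fine cells; then only \<open>t\<close> and \<open>u\<close>, in one fibre, have to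
      be compared.\<close>
    obtain u where m: "same_cell \<Xi> x s y u" using cell_transfer[OF os x y, of s] by blast
    have 1: "sgn (poly (f x) s) = sgn (poly (f y) u)" using sg m f sub x y by blast
    have c': "same_cell \<Xi>' y t y u"
      by (rule same_cell_trans[OF same_cell_sym[OF c] same_cell_mono[OF m]]) (auto simp: \<Xi>'_def)
    have "sgn (poly (f y) t) = sgn (poly (f y) u)"
    proof (rule ccontr)
      assume ne: "\<not> ?thesis"
      have "\<exists>r. min t u \<le> r \<and> r \<le> max t u \<and> poly (f y) r = 0"
        using ne poly_sgn_change_root[of "f y" t u] poly_sgn_change_root[of "f y" u t]
        by (metis linear max.absorb1 max.absorb2 min.absorb1 min.absorb2)
      then obtain r where r: "min t u \<le> r" "r \<le> max t u" "poly (f y) r = 0" by blast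
      have "f y \<noteq> 0" using ne by auto
      then obtain \<xi> where \<xi>: "\<xi> \<in> \<Xi>'" "r = \<xi> y" using roots'[OF f] y r(3) by blast
      have "t = \<xi> y \<and> u = \<xi> y"
        using same_cell_section_iff[OF c' \<xi>(1)] r(1,2) \<xi>(2) by (auto simp: min_def max_def split: if_splits)
      then show False using ne by simp
    qed
    then show ?thesis using 1 by simp
  qed
  have "sign_diagram A F' \<Xi>'"
    by (rule sign_diagramI[OF os' roots' _ sg']) (auto simp: \<Xi>'_def)
  moreover have "\<Xi>' \<subseteq> \<Xi>" by (auto simp: \<Xi>'_def)
  ultimately show ?thesis by blast
qed

section \<open>Inserting the roots of one polynomial\<close>

text \<open>The sections contain all critical points of \<open>f x\<close>, and the signs of
  \<open>f\<close> on the sections and at both infinities are constant over \<open>A\<close>. Open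
  is only where the roots of \<open>f\<close> lie inside the bands.\<close>

locale section_insertion =
  fixes A :: "'a::topological_space set" and \<Xi> :: "('a \<Rightarrow> real) set"
    and f :: "'a \<Rightarrow> real poly" and d :: nat
  assumes os: "ordered_sections A \<Xi>"
    and cont: "\<And>t. continuous_on A (\<lambda>x. poly (f x) t)"
    and deg: "\<And>x. x \<in> A \<Longrightarrow> degree (f x) = d"
    and nonzero: "\<And>x. x \<in> A \<Longrightarrow> f x \<noteq> 0"
    and lead: "\<And>x y. x \<in> A \<Longrightarrow> y \<in> A \<Longrightarrow> sgn (lead_coeff (f x)) = sgn (lead_coeff (f y))"
    and deriv_root: "\<And>x t. x \<in> A \<Longrightarrow> poly (pderiv (f x)) t = 0 \<Longrightarrow> \<exists>\<xi>\<in>\<Xi>. t = \<xi> x"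
    and deriv_sgn: "\<And>x y s t. x \<in> A \<Longrightarrow> y \<in> A \<Longrightarrow> same_cell \<Xi> x s y t \<Longrightarrow>
      sgn (poly (pderiv (f x)) s) = sgn (poly (pderiv (f y)) t)"
    and section_sgn: "\<And>\<xi> x y. \<xi> \<in> \<Xi> \<Longrightarrow> x \<in> A \<Longrightarrow> y \<in> A \<Longrightarrow>
      sgn (poly (f x) (\<xi> x)) = sgn (poly (f y) (\<xi> y))"
begin

definition in_band :: "'a \<Rightarrow> real \<Rightarrow> bool" where
  "in_band x s \<longleftrightarrow> x \<in> A \<and> (\<forall>\<xi>\<in>\<Xi>. s \<noteq> \<xi> x)"

lemma in_band_same_cell:
  assumes "in_band x s" "same_cell \<Xi> x s y t" "y \<in> A"
  shows "in_band y t"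
proof -
  have "t \<noteq> \<xi> y" if "\<xi> \<in> \<Xi>" for \<xi>
    using same_cell_section_iff(1)[OF assms(2) that] assms(1) that by (simp add: in_band_def)
  then show ?thesis using assms(3) by (simp add: in_band_def)
qed

text \<open>The band is bounded below by the largest section under \<open>s0\<close>, or unbounded.
  In the first case the sign of \<open>f\<close> on that section decides, or that of the derivative
  in the band if \<open>f\<close> vanishes there; in the second the leading coefficient and the
  degree decide. None of these depends on \<open>x\<close>.\<close>

lemma sign_low:
  assumes b: "in_band x0 s0"
  shows "\<exists>\<sigma>. \<forall>x\<in>A. \<forall>u. same_cell \<Xi> x0 s0 x u \<longrightarrow>
    (\<exists>t<u. same_cell \<Xi> x0 s0 x t \<and> sgn (poly (f x) t) = \<sigma>)"
proof -
  have x0: "x0 \<in> A" and off: "\<And>\<xi>. \<xi> \<in> \<Xi> \<Longrightarrow> s0 \<noteq> \<xi> x0" using b by (auto simp: in_band_def)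
  define L where "L = {\<xi>\<in>\<Xi>. \<xi> x0 < s0}"
  show ?thesis
  proof (cases "L = {}")
    case True
    have "\<exists>t<u. same_cell \<Xi> x0 s0 x t \<and> sgn (poly (f x) t) = sgn (lead_coeff (f x0)) * (- 1) ^ d"
      if x: "x \<in> A" and c: "same_cell \<Xi> x0 s0 x u" for x u
    proof -
      obtain B where B: "\<forall>t\<le>B. sgn (poly (f x) t) = sgn (lead_coeff (f x)) * (- 1) ^ degree (f x)"
        using sgn_poly_at_bot[OF nonzero[OF x]] by blast
      \<comment> \<open>\<open>u - 1\<close> keeps the point below \<open>u\<close>, and
        \<open>B\<close> brings it into the range where the leading term decides the sign.\<close>
      define t where "t = min (u - 1) B"
      have t: "t < u" "t \<le> B" by (auto simp: t_def)
      have "same_cell \<Xi> x0 s0 x t"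
      proof (rule same_cellI)
        fix \<xi> assume \<xi>: "\<xi> \<in> \<Xi>"
        then have lt: "s0 < \<xi> x0" using True off[OF \<xi>] by (auto simp: L_def not_less order_le_less)
        then show "t < \<xi> x" using t same_cell_section_iff(2)[OF c \<xi>] by auto
        show "\<xi> x0 < s0 \<Longrightarrow> \<xi> x < t" "s0 = \<xi> x0 \<Longrightarrow> t = \<xi> x" using lt by auto
      qed
      then show ?thesis using t B deg[OF x] lead[OF x x0] by auto
    qed
    then show ?thesis by blast
  next
    case False
    have "finite L" using os by (auto simp: L_def ordered_sections_def)
    then obtain l where l: "l \<in> L" "\<forall>\<xi>\<in>L. \<xi> x0 \<le> l x0"
      by (rule bexE[OF ex_max_on_finite[OF _ False, of "\<lambda>\<xi>. \<xi> x0"]])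
    have l\<Xi>: "l \<in> \<Xi>" and lx0: "l x0 < s0" using l by (auto simp: L_def)
    define e where "e = sgn (poly (pderiv (f x0)) s0)"
    have "\<exists>t<u. same_cell \<Xi> x0 s0 x t \<and>
        sgn (poly (f x) t) = (if poly (f x0) (l x0) = 0 then e else sgn (poly (f x0) (l x0)))"
      if x: "x \<in> A" and c: "same_cell \<Xi> x0 s0 x u" for x u
    proof -
      have cell: "same_cell \<Xi> x0 s0 x t" if t: "l x < t" "t \<le> u" for t
      proof (rule same_cellI)
        fix \<xi> assume \<xi>: "\<xi> \<in> \<Xi>"
        show "s0 < \<xi> x0 \<Longrightarrow> t < \<xi> x" using same_cell_section_iff(2)[OF c \<xi>] t by auto
        show "\<xi> x0 < s0 \<Longrightarrow> \<xi> x < t"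
          using ordered_sections_le[OF os \<xi> l\<Xi> x0 x] l(2) \<xi> t(1) by (auto simp: L_def)
        show "s0 = \<xi> x0 \<Longrightarrow> t = \<xi> x" using off[OF \<xi>] by simp
      qed
      have "\<exists>t. l x < t \<and> t < u \<and>
          sgn (poly (f x) t) = (if poly (f x) (l x) = 0 then e else sgn (poly (f x) (l x)))"
      proof (rule sgn_poly_at_right_end)
        show "l x < u" using same_cell_section_iff(3)[OF c l\<Xi>] lx0 by simp
        show "sgn (poly (pderiv (f x)) t) = e" if "l x < t" "t \<le> u" for t
          unfolding e_def using deriv_sgn[OF x0 x cell[OF that]] by simp
      qed
      moreover have "sgn (poly (f x) (l x)) = sgn (poly (f x0) (l x0))"
        by (rule section_sgn[OF l\<Xi> x x0])
      moreover from this have "poly (f x) (l x) = 0 \<longleftrightarrow> poly (f x0) (l x0) = 0"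
        by (metis sgn_zero_iff)
      ultimately show ?thesis using cell by (metis less_imp_le)
    qed
    then show ?thesis by blast
  qed
qed

text \<open>Mirror image of \<open>sign_low\<close>; at an upper section where \<open>f\<close>
  vanishes the derivative enters with the opposite sign.\<close>

lemma sign_high:
  assumes b: "in_band x0 s0"
  shows "\<exists>\<sigma>. \<forall>x\<in>A. \<forall>u. same_cell \<Xi> x0 s0 x u \<longrightarrow>
    (\<exists>t>u. same_cell \<Xi> x0 s0 x t \<and> sgn (poly (f x) t) = \<sigma>)"
proof -
  have x0: "x0 \<in> A" and off: "\<And>\<xi>. \<xi> \<in> \<Xi> \<Longrightarrow> s0 \<noteq> \<xi> x0" using b by (auto simp: in_band_def)
  define U where "U = {\<xi>\<in>\<Xi>. s0 < \<xi> x0}"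
  show ?thesis
  proof (cases "U = {}")
    case True
    have "\<exists>t>u. same_cell \<Xi> x0 s0 x t \<and> sgn (poly (f x) t) = sgn (lead_coeff (f x0))"
      if x: "x \<in> A" and c: "same_cell \<Xi> x0 s0 x u" for x u
    proof -
      obtain B where B: "\<forall>t\<ge>B. sgn (poly (f x) t) = sgn (lead_coeff (f x))"
        using sgn_poly_at_top[OF nonzero[OF x]] by blast
      define t where "t = max (u + 1) B"
      have t: "u < t" "B \<le> t" by (auto simp: t_def)
      have "same_cell \<Xi> x0 s0 x t"
      proof (rule same_cellI)
        fix \<xi> assume \<xi>: "\<xi> \<in> \<Xi>"
        then have lt: "\<xi> x0 < s0" using True off[OF \<xi>] by (auto simp: U_def not_less order_le_less)
        then show "\<xi> x < t" using t same_cell_section_iff(3)[OF c \<xi>] by auto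
        show "s0 < \<xi> x0 \<Longrightarrow> t < \<xi> x" "s0 = \<xi> x0 \<Longrightarrow> t = \<xi> x" using lt by auto
      qed
      then show ?thesis using t B lead[OF x x0] by auto
    qed
    then show ?thesis by blast
  next
    case False
    have "finite U" using os by (auto simp: U_def ordered_sections_def)
    then obtain l where l: "l \<in> U" "\<forall>\<xi>\<in>U. l x0 \<le> \<xi> x0"
      by (rule bexE[OF ex_min_on_finite[OF _ False, of "\<lambda>\<xi>. \<xi> x0"]])
    have l\<Xi>: "l \<in> \<Xi>" and lx0: "s0 < l x0" using l by (auto simp: U_def)
    define e where "e = sgn (poly (pderiv (f x0)) s0)"
    have "\<exists>t>u. same_cell \<Xi> x0 s0 x t \<and>
        sgn (poly (f x) t) = (if poly (f x0) (l x0) = 0 then - e else sgn (poly (f x0) (l x0)))"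
      if x: "x \<in> A" and c: "same_cell \<Xi> x0 s0 x u" for x u
    proof -
      have cell: "same_cell \<Xi> x0 s0 x t" if t: "u \<le> t" "t < l x" for t
      proof (rule same_cellI)
        fix \<xi> assume \<xi>: "\<xi> \<in> \<Xi>"
        show "\<xi> x0 < s0 \<Longrightarrow> \<xi> x < t" using same_cell_section_iff(3)[OF c \<xi>] t by auto
        show "s0 < \<xi> x0 \<Longrightarrow> t < \<xi> x"
          using ordered_sections_le[OF os l\<Xi> \<xi> x0 x] l(2) \<xi> t(2) by (auto simp: U_def)
        show "s0 = \<xi> x0 \<Longrightarrow> t = \<xi> x" using off[OF \<xi>] by simp
      qed
      have "\<exists>t. u < t \<and> t < l x \<and>
          sgn (poly (f x) t) = (if poly (f x) (l x) = 0 then - e else sgn (poly (f x) (l x)))"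
      proof (rule sgn_poly_at_left_end)
        show "u < l x" using same_cell_section_iff(2)[OF c l\<Xi>] lx0 by simp
        show "sgn (poly (pderiv (f x)) t) = e" if "u \<le> t" "t < l x" for t
          unfolding e_def using deriv_sgn[OF x0 x cell[OF that]] by simp
      qed
      moreover have "sgn (poly (f x) (l x)) = sgn (poly (f x0) (l x0))"
        by (rule section_sgn[OF l\<Xi> x x0])
      moreover from this have "poly (f x) (l x) = 0 \<longleftrightarrow> poly (f x0) (l x0) = 0"
        by (metis sgn_zero_iff)
      ultimately show ?thesis using cell by (metis less_imp_le)
    qed
    then show ?thesis by blast
  qed
qed

text \<open>Rolle: a critical point between two roots lies in the same band by convexity, but
  critical points lie on sections.\<close>

lemma band_root_unique:
  assumes b: "in_band x s" and c: "same_cell \<Xi> x s x t"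
    and 0: "poly (f x) s = 0" "poly (f x) t = 0"
  shows "s = t"
proof (rule ccontr)
  have x: "x \<in> A" using b by (simp add: in_band_def)
  have *: False if b: "in_band x a" and c: "same_cell \<Xi> x a x b" and 0: "poly (f x) a = 0" "poly (f x) b = 0"
    and "a < b" for a b
  proof -
    obtain z where z: "a < z" "z < b" "poly (f x) b - poly (f x) a = (b - a) * poly (pderiv (f x)) z"
      using poly_MVT[OF \<open>a < b\<close>] by blast
    then have "poly (pderiv (f x)) z = 0" using 0 \<open>a < b\<close> by simp
    moreover have "same_cell \<Xi> x a x z"
      using same_cell_convex[OF _ c, of a z] z(1,2) by (simp add: same_cell_def)
    ultimately have "in_band x z" "\<exists>\<xi>\<in>\<Xi>. z = \<xi> x"
      using in_band_same_cell[OF b _ x] deriv_root[OF x] by simp_all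
    then show False by (simp add: in_band_def)
  qed
  assume "s \<noteq> t"
  then show False
    using *[OF b c 0] *[OF in_band_same_cell[OF b c x] same_cell_sym[OF c] 0(2,1)] by linarith
qed

text \<open>The signs at the two ends of a band, expressed by points beyond any given
  \<open>u\<close> so that bounded and unbounded bands are treated alike. The same two values serve
  all fibres.\<close>

definition end_signs :: "'a \<Rightarrow> real \<Rightarrow> real \<Rightarrow> real \<Rightarrow> bool" where
  "end_signs x0 s0 \<sigma> \<tau> \<longleftrightarrow> (\<forall>x\<in>A. \<forall>u. same_cell \<Xi> x0 s0 x u \<longrightarrow>
    (\<exists>t<u. same_cell \<Xi> x0 s0 x t \<and> sgn (poly (f x) t) = \<sigma>) \<and>
    (\<exists>t>u. same_cell \<Xi> x0 s0 x t \<and> sgn (poly (f x) t) = \<tau>))"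

lemma ex_end_signs:
  assumes "in_band x0 s0"
  shows "\<exists>\<sigma> \<tau>. end_signs x0 s0 \<sigma> \<tau>"
proof -
  obtain \<sigma> where "\<forall>x\<in>A. \<forall>u. same_cell \<Xi> x0 s0 x u \<longrightarrow>
    (\<exists>t<u. same_cell \<Xi> x0 s0 x t \<and> sgn (poly (f x) t) = \<sigma>)"
    using sign_low[OF assms] by (rule exE)
  moreover obtain \<tau> where "\<forall>x\<in>A. \<forall>u. same_cell \<Xi> x0 s0 x u \<longrightarrow>
    (\<exists>t>u. same_cell \<Xi> x0 s0 x t \<and> sgn (poly (f x) t) = \<tau>)"
    using sign_high[OF assms] by (rule exE)
  ultimately show ?thesis unfolding end_signs_def by (intro exI[of _ \<sigma>] exI[of _ \<tau>]) simp
qed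

lemma sgn_below_roots:
  assumes "end_signs x0 s0 \<sigma> \<tau>" "x \<in> A" "same_cell \<Xi> x0 s0 x u"
    and "\<And>t. t \<le> u \<Longrightarrow> same_cell \<Xi> x0 s0 x t \<Longrightarrow> poly (f x) t \<noteq> 0"
  shows "sgn (poly (f x) u) = \<sigma>"
proof (rule ccontr)
  assume ne: "\<not> ?thesis"
  obtain t where t: "t < u" "same_cell \<Xi> x0 s0 x t" "sgn (poly (f x) t) = \<sigma>"
    using assms(1-3) unfolding end_signs_def by blast
  then obtain r where "t \<le> r" "r \<le> u" "poly (f x) r = 0"
    using poly_sgn_change_root[of "f x" t u] ne by auto
  then show False using assms(4) same_cell_convex[OF t(2) assms(3)] by blast
qed

lemma sgn_above_roots:
  assumes "end_signs x0 s0 \<sigma> \<tau>" "x \<in> A" "same_cell \<Xi> x0 s0 x u"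
    and "\<And>t. t \<ge> u \<Longrightarrow> same_cell \<Xi> x0 s0 x t \<Longrightarrow> poly (f x) t \<noteq> 0"
  shows "sgn (poly (f x) u) = \<tau>"
proof (rule ccontr)
  assume ne: "\<not> ?thesis"
  obtain t where t: "u < t" "same_cell \<Xi> x0 s0 x t" "sgn (poly (f x) t) = \<tau>"
    using assms(1-3) unfolding end_signs_def by blast
  then obtain r where "u \<le> r" "r \<le> t" "poly (f x) r = 0"
    using poly_sgn_change_root[of "f x" u t] ne by auto
  then show False using assms(4) same_cell_convex[OF assms(3) t(2)] by blast
qed

text \<open>The derivative has one and the same sign on both sides of \<open>r\<close>, so
  \<open>f\<close> takes opposite signs there. Equal end signs would both be 0, giving a second root
  in the band.\<close>

lemma end_signs_differ:
  assumes b: "in_band x r" and 0: "poly (f x) r = 0" and e: "end_signs x r \<sigma> \<tau>"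
  shows "\<sigma> \<noteq> \<tau>"
proof
  assume eq: "\<sigma> = \<tau>"
  have x: "x \<in> A" using b by (simp add: in_band_def)
  have rr: "same_cell \<Xi> x r x r" by (simp add: same_cell_def)
  obtain t where t: "t < r" "same_cell \<Xi> x r x t" "sgn (poly (f x) t) = \<sigma>"
    using e x rr unfolding end_signs_def by blast
  obtain u where u: "r < u" "same_cell \<Xi> x r x u" "sgn (poly (f x) u) = \<tau>"
    using e x rr unfolding end_signs_def by blast
  obtain c where c: "t < c" "c < r" "poly (f x) r - poly (f x) t = (r - t) * poly (pderiv (f x)) c"
    using poly_MVT[OF t(1)] by blast
  obtain c' where c': "r < c'" "c' < u" "poly (f x) u - poly (f x) r = (u - r) * poly (pderiv (f x)) c'"
    using poly_MVT[OF u(1)] by blast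
  have "same_cell \<Xi> x r x c" using same_cell_convex[OF t(2) rr] c by simp
  moreover have "same_cell \<Xi> x r x c'" using same_cell_convex[OF rr u(2)] c' by simp
  ultimately have ee: "sgn (poly (pderiv (f x)) c) = sgn (poly (pderiv (f x)) c')"
    using deriv_sgn[OF x x, of r c] deriv_sgn[OF x x, of r c'] by simp
  have "poly (f x) t = - ((r - t) * poly (pderiv (f x)) c)" using c(3) 0 by simp
  then have 1: "sgn (poly (f x) t) = - sgn (poly (pderiv (f x)) c)"
    using t(1) by (simp add: sgn_mult sgn_minus)
  have "sgn (poly (f x) u) = sgn (poly (pderiv (f x)) c')"
    using u(1) c'(3) 0 by (simp add: sgn_mult)
  then have "sgn (poly (f x) t) = 0" using 1 ee eq t(3) u(3) by simp
  then have "poly (f x) t = 0" by (simp add: sgn_zero_iff)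
  then show False using band_root_unique[OF b t(2) 0] t(1) by simp
qed

text \<open>The end signs differ because of the root over \<open>x\<close>, and they hold over
  \<open>y\<close> as well, so the intermediate value theorem gives a root over \<open>y\<close> in
  the same band.\<close>

lemma root_transfer:
  assumes b: "in_band x r" and 0: "poly (f x) r = 0" and y: "y \<in> A"
  shows "\<exists>t. same_cell \<Xi> x r y t \<and> poly (f y) t = 0"
proof -
  have x: "x \<in> A" using b by (simp add: in_band_def)
  obtain \<sigma> \<tau> where e: "end_signs x r \<sigma> \<tau>" using ex_end_signs[OF b] by blast
  have ne: "\<sigma> \<noteq> \<tau>" by (rule end_signs_differ[OF b 0 e])
  obtain u where u: "same_cell \<Xi> x r y u" using cell_transfer[OF os x y] by blast
  obtain t where t: "t < u" "same_cell \<Xi> x r y t" "sgn (poly (f y) t) = \<sigma>"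
    using e y u unfolding end_signs_def by blast
  obtain v where v: "u < v" "same_cell \<Xi> x r y v" "sgn (poly (f y) v) = \<tau>"
    using e y u unfolding end_signs_def by blast
  obtain q where "t \<le> q" "q \<le> v" "poly (f y) q = 0"
    using poly_sgn_change_root[of "f y" t v] ne t v by auto
  then show ?thesis using same_cell_convex[OF t(2) v(2)] by blast
qed

text \<open>By continuity of the finitely many sections, a point off them stays on the same side of
  each when its height is kept and the base point moves slightly.\<close>

lemma eventually_same_cell:
  assumes "in_band x s"
  shows "\<forall>\<^sub>F y in at x within A. same_cell \<Xi> x s y s"
  unfolding same_cell_def
proof (rule eventually_ball_finite)
  show "finite \<Xi>" using os by (simp add: ordered_sections_def)
  show "\<forall>\<xi>\<in>\<Xi>. \<forall>\<^sub>F y in at x within A. sgn (s - \<xi> x) = sgn (s - \<xi> y)"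
  proof
    fix \<xi> assume \<xi>: "\<xi> \<in> \<Xi>"
    have lim: "(\<xi> \<longlongrightarrow> \<xi> x) (at x within A)"
      using os \<xi> assms by (auto simp: ordered_sections_def in_band_def continuous_on_def)
    have "s \<noteq> \<xi> x" using assms \<xi> by (auto simp: in_band_def)
    then consider "s < \<xi> x" | "\<xi> x < s" by linarith
    then show "\<forall>\<^sub>F y in at x within A. sgn (s - \<xi> x) = sgn (s - \<xi> y)"
    proof cases
      case 1
      from order_tendstoD(1)[OF lim this] show ?thesis
        by eventually_elim (use 1 in \<open>simp add: sgn_if\<close>)
    next
      case 2
      from order_tendstoD(2)[OF lim this] show ?thesis
        by eventually_elim (use 2 in \<open>simp add: sgn_if\<close>)
    qed
  qed
qed

lemma eventually_sgn:
  assumes "x \<in> A" "poly (f x) s \<noteq> 0"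
  shows "\<forall>\<^sub>F y in at x within A. sgn (poly (f y) s) = sgn (poly (f x) s)"
proof -
  have lim: "((\<lambda>y. poly (f y) s) \<longlongrightarrow> poly (f x) s) (at x within A)"
    using cont[of s] assms(1) by (auto simp: continuous_on_def)
  consider "poly (f x) s < 0" | "0 < poly (f x) s" using assms(2) by linarith
  then show ?thesis
  proof cases
    case 1
    from order_tendstoD(2)[OF lim this] show ?thesis
      by eventually_elim (use 1 in \<open>simp add: sgn_if\<close>)
  next
    case 2
    from order_tendstoD(1)[OF lim this] show ?thesis
      by eventually_elim (use 2 in \<open>simp add: sgn_if\<close>)
  qed
qed

definition root_section :: "'a \<Rightarrow> real \<Rightarrow> 'a \<Rightarrow> real" where
  "root_section x0 r x = (SOME t. same_cell \<Xi> x0 r x t \<and> poly (f x) t = 0)"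

context
  fixes x0 r
  assumes b: "in_band x0 r" and r0: "poly (f x0) r = 0"
begin

lemma root_section:
  assumes "x \<in> A"
  shows "same_cell \<Xi> x0 r x (root_section x0 r x)" "poly (f x) (root_section x0 r x) = 0"
  using someI_ex[OF root_transfer[OF b r0 assms]] by (simp_all add: root_section_def)

lemma root_section_eq:
  assumes "x \<in> A" "same_cell \<Xi> x0 r x t" "poly (f x) t = 0"
  shows "t = root_section x0 r x"
  by (rule band_root_unique[OF in_band_same_cell[OF b assms(2,1)]
    same_cell_trans[OF same_cell_sym[OF assms(2)] root_section(1)[OF assms(1)]]
    assms(3) root_section(2)[OF assms(1)]])

text \<open>The signs at \<open>s\<close> and \<open>t\<close> are the two different end signs. For
  nearby \<open>y\<close> the points keep their signs and their band, so the unique root over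
  \<open>y\<close> is still enclosed.\<close>

lemma eventually_root_section_between:
  assumes x: "x \<in> A" and s: "same_cell \<Xi> x0 r x s" "s < root_section x0 r x"
    and t: "same_cell \<Xi> x0 r x t" "root_section x0 r x < t"
  shows "\<forall>\<^sub>F y in at x within A. s \<le> root_section x0 r y \<and> root_section x0 r y \<le> t"
proof -
  obtain \<sigma> \<tau> where e: "end_signs x0 r \<sigma> \<tau>" using ex_end_signs[OF b] by blast
  have ne: "\<sigma> \<noteq> \<tau>" by (rule end_signs_differ[OF b r0 e])
  have s\<sigma>: "sgn (poly (f x) s) = \<sigma>"
    using root_section_eq[OF x] s(2) by (intro sgn_below_roots[OF e x s(1)]) force
  have t\<tau>: "sgn (poly (f x) t) = \<tau>"
    using root_section_eq[OF x] t(2) by (intro sgn_above_roots[OF e x t(1)]) force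
  have s0: "poly (f x) s \<noteq> 0" and t0: "poly (f x) t \<noteq> 0"
    using root_section_eq[OF x s(1)] root_section_eq[OF x t(1)] s(2) t(2) by auto
  have bs: "in_band x s" and bt: "in_band x t"
    using in_band_same_cell[OF b _ x] s(1) t(1) by blast+
  have "\<forall>\<^sub>F y in at x within A. y \<in> A"
    by (auto simp: eventually_at_filter)
  then show ?thesis
    using eventually_same_cell[OF bs] eventually_same_cell[OF bt] eventually_sgn[OF x s0] eventually_sgn[OF x t0]
  proof eventually_elim
    case (elim y)
    obtain q where q: "s \<le> q" "q \<le> t" "poly (f y) q = 0"
      using poly_sgn_change_root[of "f y" s t] ne s\<sigma> t\<tau> elim s(2) t(2) by auto
    have "same_cell \<Xi> x0 r y q"
      by (rule same_cell_convex[OF same_cell_trans[OF s(1) elim(2)] same_cell_trans[OF t(1) elim(3)] q(1,2)])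
    then show ?case using root_section_eq[OF elim(1) _ q(3)] q by simp
  qed
qed

lemma continuous_root_section: "continuous_on A (root_section x0 r)"
  unfolding continuous_on_def
proof
  fix x assume x: "x \<in> A"
  let ?\<rho> = "root_section x0 r"
  obtain \<sigma> \<tau> where e: "end_signs x0 r \<sigma> \<tau>" using ex_end_signs[OF b] by blast
  note c = root_section[OF x]
  obtain s where s: "s < ?\<rho> x" "same_cell \<Xi> x0 r x s" using e x c(1) unfolding end_signs_def by blast
  obtain t where t: "?\<rho> x < t" "same_cell \<Xi> x0 r x t" using e x c(1) unfolding end_signs_def by blast
  show "(?\<rho> \<longlongrightarrow> ?\<rho> x) (at x within A)"
  proof (rule order_tendstoI)
    fix a assume a: "a < ?\<rho> x"
    \<comment> \<open>The midpoint with \<open>a\<close> turns the weak bound on nearby roots into a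
      strict one; the maximum with \<open>s\<close> keeps \<open>s'\<close> in the band.\<close>
    define s' where "s' = max s ((a + ?\<rho> x) / 2)"
    have s': "s \<le> s'" "s' < ?\<rho> x" "a < s'" using a s(1) unfolding s'_def max_def by (auto split: if_splits)
    have "same_cell \<Xi> x0 r x s'" using same_cell_convex[OF s(2) c(1)] s' by simp
    from eventually_root_section_between[OF x this s'(2) t(2,1)]
    show "\<forall>\<^sub>F y in at x within A. a < ?\<rho> y"
      by eventually_elim (use s' in simp)
  next
    fix a assume a: "?\<rho> x < a"
    define t' where "t' = min t ((a + ?\<rho> x) / 2)"
    have t': "t' \<le> t" "?\<rho> x < t'" "t' < a" using a t(1) unfolding t'_def min_def by (auto split: if_splits)
    have "same_cell \<Xi> x0 r x t'" using same_cell_convex[OF c(1) t(2)] t' by simp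
    from eventually_root_section_between[OF x s(2,1) this t'(2)]
    show "\<forall>\<^sub>F y in at x within A. ?\<rho> y < a"
      by eventually_elim (use t' in simp)
  qed
qed

end

text \<open>Different roots over \<open>x0\<close> lie in different bands, hence an old section
  separates them, and a root section never leaves its band.\<close>

lemma root_section_mono:
  assumes b: "in_band x0 r" "poly (f x0) r = 0" and b': "in_band x0 r'" "poly (f x0) r' = 0"
    and "r < r'" "x \<in> A"
  shows "root_section x0 r x < root_section x0 r' x"
proof -
  have "\<not> same_cell \<Xi> x0 r x0 r'" using band_root_unique[OF b(1) _ b(2) b'(2)] \<open>r < r'\<close> by auto
  then obtain \<xi> where \<xi>: "\<xi> \<in> \<Xi>" "sgn (r - \<xi> x0) \<noteq> sgn (r' - \<xi> x0)" by (auto simp: same_cell_def)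
  moreover have "r \<noteq> \<xi> x0" "r' \<noteq> \<xi> x0" using b b' \<xi> by (auto simp: in_band_def)
  ultimately have "r < \<xi> x0" "\<xi> x0 < r'" using \<open>r < r'\<close> by (auto simp: sgn_if split: if_splits)
  then have "root_section x0 r x < \<xi> x" "\<xi> x < root_section x0 r' x"
    using same_cell_section_iff[OF root_section(1)[OF b \<open>x \<in> A\<close>] \<xi>(1)]
      same_cell_section_iff[OF root_section(1)[OF b' \<open>x \<in> A\<close>] \<xi>(1)] by auto
  then show ?thesis by simp
qed

text \<open>One root section is added for each root over a base point that lies inside a band. Each
  band then either has no root and one sign, or is divided by its root section into two parts
  carrying the two end signs.\<close>

lemma insert_root_sections:
  "\<exists>\<Xi>'. \<Xi> \<subseteq> \<Xi>' \<and> ordered_sections A \<Xi>' \<and>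
    (\<forall>\<xi>\<in>\<Xi>' - \<Xi>. \<forall>x\<in>A. poly (f x) (\<xi> x) = 0) \<and>
    (\<forall>x\<in>A. \<forall>t. poly (f x) t = 0 \<longrightarrow> (\<exists>\<xi>\<in>\<Xi>'. t = \<xi> x)) \<and>
    (\<forall>x\<in>A. \<forall>y\<in>A. \<forall>s t. same_cell \<Xi>' x s y t \<longrightarrow> sgn (poly (f x) s) = sgn (poly (f y) t))"
proof (cases "A = {}")
  case True
  then show ?thesis using os by (intro exI[of _ \<Xi>]) simp
next
  case False
  then obtain x0 where x0: "x0 \<in> A" by blast
  \<comment> \<open>Roots on old sections are left out, as those sections already belong to
    \<open>\<Xi>\<close>.\<close>
  define R where "R = {r. in_band x0 r \<and> poly (f x0) r = 0}"
  define \<Xi>' where "\<Xi>' = \<Xi> \<union> root_section x0 ` R"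
  have finR: "finite R"
    by (rule finite_subset[OF _ poly_roots_finite[OF nonzero[OF x0]]]) (auto simp: R_def)
  have ord: "\<alpha> y < \<beta> y" if "\<alpha> \<in> \<Xi>'" "\<beta> \<in> \<Xi>'" "x \<in> A" "y \<in> A" "\<alpha> x < \<beta> x" for \<alpha> \<beta> x y
  proof -
    consider "\<alpha> \<in> \<Xi>" "\<beta> \<in> \<Xi>" | r where "\<alpha> \<in> \<Xi>" "r \<in> R" "\<beta> = root_section x0 r"
      | r where "r \<in> R" "\<alpha> = root_section x0 r" "\<beta> \<in> \<Xi>"
      | r r' where "r \<in> R" "\<alpha> = root_section x0 r" "r' \<in> R" "\<beta> = root_section x0 r'"
      using \<open>\<alpha> \<in> \<Xi>'\<close> \<open>\<beta> \<in> \<Xi>'\<close> unfolding \<Xi>'_def by auto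
    then show ?thesis
    proof cases
      case 1
      then show ?thesis using os that unfolding ordered_sections_def by blast
    next
      case 2
      then show ?thesis
        using same_cell_section_iff(3)[OF root_section(1)[of x0 r x] \<open>\<alpha> \<in> \<Xi>\<close>]
          same_cell_section_iff(3)[OF root_section(1)[of x0 r y] \<open>\<alpha> \<in> \<Xi>\<close>] that
        by (simp add: R_def)
    next
      case 3
      then show ?thesis
        using same_cell_section_iff(2)[OF root_section(1)[of x0 r x] \<open>\<beta> \<in> \<Xi>\<close>]
          same_cell_section_iff(2)[OF root_section(1)[of x0 r y] \<open>\<beta> \<in> \<Xi>\<close>] that
        by (simp add: R_def)
    next
      case 4
      have "r < r'"
      proof (rule ccontr)
        assume "\<not> r < r'"
        then consider "r = r'" | "r' < r" by linarith
        then show False using 4 that root_section_mono[of x0 r' r x] by cases (auto simp: R_def)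
      qed
      then show ?thesis using 4 that root_section_mono[of x0 r r' y] by (auto simp: R_def)
    qed
  qed
  have os': "ordered_sections A \<Xi>'"
    unfolding ordered_sections_def
  proof (intro conjI ballI impI)
    show "finite \<Xi>'" using os finR by (simp add: \<Xi>'_def ordered_sections_def)
    show "continuous_on A \<xi>" if "\<xi> \<in> \<Xi>'" for \<xi>
      using that os continuous_root_section by (auto simp: \<Xi>'_def R_def ordered_sections_def)
    show "\<beta> x < \<gamma> x \<Longrightarrow> \<beta> y < \<gamma> y" if "\<beta> \<in> \<Xi>'" "\<gamma> \<in> \<Xi>'" "x \<in> A" "y \<in> A" for \<beta> \<gamma> x y
      using ord[OF that] .
  qed
  have zero: "\<forall>\<xi>\<in>\<Xi>' - \<Xi>. \<forall>x\<in>A. poly (f x) (\<xi> x) = 0"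
    using root_section(2) by (auto simp: \<Xi>'_def R_def)
  \<comment> \<open>Every root inside a band over any \<open>x\<close> is traced back to one over
    \<open>x0\<close>, so no root section is missing.\<close>
  have band_root: "\<exists>q\<in>R. t = root_section x0 q x" if bt: "in_band x t" and 0: "poly (f x) t = 0" for x t
  proof -
    have x: "x \<in> A" using bt by (simp add: in_band_def)
    obtain q where q: "same_cell \<Xi> x t x0 q" "poly (f x0) q = 0"
      using root_transfer[OF bt 0 x0] by blast
    have bq: "in_band x0 q" by (rule in_band_same_cell[OF bt q(1) x0])
    then show ?thesis using root_section_eq[OF bq q(2) x same_cell_sym[OF q(1)] 0] q by (auto simp: R_def)
  qed
  have roots: "\<exists>\<xi>\<in>\<Xi>'. t = \<xi> x" if "x \<in> A" "poly (f x) t = 0" for x t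
    using band_root[of x t] that by (cases "in_band x t") (auto simp: \<Xi>'_def in_band_def)
  have sg: "sgn (poly (f x) s) = sgn (poly (f y) t)"
    if x: "x \<in> A" and y: "y \<in> A" and c': "same_cell \<Xi>' x s y t" for x y s t
  proof (cases "\<exists>\<xi>\<in>\<Xi>'. s = \<xi> x")
    case True
    then obtain \<xi> where \<xi>: "\<xi> \<in> \<Xi>'" "s = \<xi> x" by blast
    then have t: "t = \<xi> y" using same_cell_section_iff(1)[OF c' \<xi>(1)] by simp
    show ?thesis
    proof (cases "\<xi> \<in> \<Xi>")
      case True
      then show ?thesis using section_sgn[OF True x y] \<xi> t by simp
    next
      case False
      then show ?thesis using zero x y \<xi> t by simp
    qed
  next
    case False
    have c: "same_cell \<Xi> x s y t" by (rule same_cell_mono[OF c']) (simp add: \<Xi>'_def)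
    have b: "in_band x s" using False x by (auto simp: in_band_def \<Xi>'_def)
    have bt: "in_band y t" by (rule in_band_same_cell[OF b c y])
    have ss: "same_cell \<Xi> x s x s" by (simp add: same_cell_def)
    obtain \<sigma> \<tau> where e: "end_signs x s \<sigma> \<tau>" using ex_end_signs[OF b] by blast
    show ?thesis
    proof (cases "\<exists>r. same_cell \<Xi> x s x r \<and> poly (f x) r = 0")
      case True
      then obtain r where r: "same_cell \<Xi> x s x r" "poly (f x) r = 0" by blast
      obtain q where q: "q \<in> R" "r = root_section x0 q x"
        using band_root[OF in_band_same_cell[OF b r(1) x] r(2)] by blast
      let ?\<rho> = "root_section x0 q"
      have \<rho>: "?\<rho> \<in> \<Xi>'" using q by (simp add: \<Xi>'_def)
      have br: "in_band x r" by (rule in_band_same_cell[OF b r(1) x])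
      have qR: "in_band x0 q" "poly (f x0) q = 0" using q by (auto simp: R_def)
      have cy: "same_cell \<Xi> x s y (?\<rho> y)"
        by (rule same_cell_trans[OF r(1)[unfolded q(2)]
          same_cell_trans[OF same_cell_sym[OF root_section(1)[OF qR x]] root_section(1)[OF qR y]]])
      have ux: "v = ?\<rho> x" if "same_cell \<Xi> x s x v" "poly (f x) v = 0" for v
        using band_root_unique[OF br same_cell_trans[OF same_cell_sym[OF r(1)] that(1)] r(2) that(2)] q(2) by simp
      have uy: "v = ?\<rho> y" if "same_cell \<Xi> x s y v" "poly (f y) v = 0" for v
        using band_root_unique[OF in_band_same_cell[OF b cy y] same_cell_trans[OF same_cell_sym[OF cy] that(1)] root_section(2)[OF qR y] that(2)]
        by simp
      have "s \<noteq> ?\<rho> x" using False \<rho> by blast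
      then consider "s < ?\<rho> x" | "?\<rho> x < s" by linarith
      then show ?thesis
      proof cases
        case 1
        then have "t < ?\<rho> y" using same_cell_section_iff(2)[OF c' \<rho>] by simp
        then have "sgn (poly (f y) t) = \<sigma>" using uy by (intro sgn_below_roots[OF e y c]) force
        moreover have "sgn (poly (f x) s) = \<sigma>" using 1 ux by (intro sgn_below_roots[OF e x ss]) force
        ultimately show ?thesis by simp
      next
        case 2
        then have "?\<rho> y < t" using same_cell_section_iff(3)[OF c' \<rho>] by simp
        then have "sgn (poly (f y) t) = \<tau>" using uy by (intro sgn_above_roots[OF e y c]) force
        moreover have "sgn (poly (f x) s) = \<tau>" using 2 ux by (intro sgn_above_roots[OF e x ss]) force
        ultimately show ?thesis by simp
      qed
    next
      case no_root: False
      have no_root_y: "poly (f y) v \<noteq> 0" if v: "same_cell \<Xi> x s y v" for v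
      proof
        assume "poly (f y) v = 0"
        then obtain q where "same_cell \<Xi> y v x q" "poly (f x) q = 0"
          using root_transfer[OF in_band_same_cell[OF b v y] _ x] by blast
        then show False using no_root same_cell_trans[OF v] by blast
      qed
      have "sgn (poly (f x) s) = \<sigma>" using no_root by (intro sgn_below_roots[OF e x ss]) blast
      moreover have "sgn (poly (f y) t) = \<sigma>" using no_root_y by (intro sgn_below_roots[OF e y c]) blast
      ultimately show ?thesis by simp
    qed
  qed
  show ?thesis
    by (intro exI[of _ \<Xi>'] conjI os' zero ballI allI impI roots sg) (simp_all add: \<Xi>'_def)
qed

end

section \<open>Existence of sign diagrams\<close>

lemma poly_fun_diff:
  assumes "poly_fun n p" "poly_fun n q"
  shows "poly_fun n (\<lambda>x. p x - q x)"
  using pf_add[OF assms(1) pf_mult[OF pf_const[of n "- 1"] assms(2)]] by simp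

lemma poly_fun_power:
  assumes "poly_fun n p"
  shows "poly_fun n (\<lambda>x. p x ^ k)"
proof (induction k)
  case 0
  show ?case using pf_const[of n 1] by simp
next
  case (Suc k)
  from pf_mult[OF assms Suc] show ?case by simp
qed

lemma poly_fun_sum:
  assumes "finite I" "\<And>i. i \<in> I \<Longrightarrow> poly_fun n (p i)"
  shows "poly_fun n (\<lambda>x. \<Sum>i\<in>I. p i x)"
  using assms
proof (induction I rule: finite_induct)
  case empty
  show ?case using pf_const[of n 0] by simp
next
  case (insert i I)
  then show ?case using pf_add[of n "p i" "\<lambda>x. \<Sum>i\<in>I. p i x"] by simp
qed

lemma continuous_poly_fun:
  assumes "poly_fun n p"
  shows "continuous_on UNIV p"
  using assms by induction (simp_all add: continuous_on_add continuous_on_mult)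

text \<open>\<open>d\<close> only bounds the degree; the true degree may drop at particular
  \<open>x\<close>. The induction on degrees uses this formal bound.\<close>

definition poly_family :: "nat \<Rightarrow> nat \<Rightarrow> ((nat \<Rightarrow> real) \<Rightarrow> real poly) \<Rightarrow> bool" where
  "poly_family n d f \<longleftrightarrow> (\<forall>i. poly_fun n (\<lambda>x. coeff (f x) i)) \<and> (\<forall>x. degree (f x) \<le> d)"

lemma poly_family_mono: "poly_family n d f \<Longrightarrow> d \<le> e \<Longrightarrow> poly_family n e f"
  by (simp add: poly_family_def le_trans[where j = d and k = e])

lemma poly_altdef_degree_le:
  fixes p :: "real poly"
  assumes "degree p \<le> n"
  shows "poly p t = (\<Sum>i\<le>n. coeff p i * t ^ i)"
proof -
  have "(\<Sum>i\<le>degree p. coeff p i * t ^ i) = (\<Sum>i\<le>n. coeff p i * t ^ i)"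
    using assms by (intro sum.mono_neutral_left) (auto simp: coeff_eq_0)
  then show ?thesis by (simp add: poly_altdef)
qed

lemma continuous_poly_family:
  assumes "poly_family n d f"
  shows "continuous_on A (\<lambda>x. poly (f x) t)"
proof -
  have "continuous_on UNIV (\<lambda>x. coeff (f x) i)" for i
    by (rule continuous_poly_fun[of n]) (use assms in \<open>simp add: poly_family_def\<close>)
  then have "continuous_on A (\<lambda>x. coeff (f x) i)" for i
    by (rule continuous_on_subset) simp
  then have "continuous_on A (\<lambda>x. \<Sum>i\<le>d. coeff (f x) i * t ^ i)"
    by (intro continuous_intros)
  moreover have "poly (f x) t = (\<Sum>i\<le>d. coeff (f x) i * t ^ i)" for x
    using assms by (intro poly_altdef_degree_le) (simp add: poly_family_def)
  ultimately show ?thesis by simp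
qed

lemma poly_family_cutoff:
  assumes "poly_family n (Suc d) f"
  shows "poly_family n d (\<lambda>x. poly_cutoff (Suc d) (f x))"
  unfolding poly_family_def
proof (intro conjI allI)
  show "poly_fun n (\<lambda>x. coeff (poly_cutoff (Suc d) (f x)) i)" for i
    using assms pf_const[of n 0] by (cases "i < Suc d") (simp_all add: poly_family_def coeff_poly_cutoff)
  show "degree (poly_cutoff (Suc d) (f x)) \<le> d" for x
    by (rule degree_le) (simp add: coeff_poly_cutoff)
qed

lemma poly_family_pderiv:
  assumes "poly_family n (Suc d) f"
  shows "poly_family n d (\<lambda>x. pderiv (f x))"
  unfolding poly_family_def
proof (intro conjI allI)
  show "poly_fun n (\<lambda>x. coeff (pderiv (f x)) i)" for i
    using assms pf_mult[OF pf_const] by (simp add: poly_family_def coeff_pderiv)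
  show "degree (pderiv (f x)) \<le> d" for x
    using assms by (auto simp: poly_family_def degree_pderiv le_diff_conv)
qed

text \<open>At a root of \<open>g x\<close>, if \<open>g x\<close> has degree \<open>k\<close>, this takes the value of \<open>f x\<close> times the leading
  coefficient of \<open>g x\<close>; and its formal degree is smaller than the formal degree \<open>d\<close> of \<open>f\<close>.\<close>

definition pseudo_reduce :: "nat \<Rightarrow> ('a \<Rightarrow> real poly) \<Rightarrow> ('a \<Rightarrow> real poly) \<Rightarrow> nat \<Rightarrow> 'a \<Rightarrow> real poly" where
  "pseudo_reduce d f g k x =
     smult (coeff (g x) k) (f x) - monom (coeff (f x) d) (d - k) * poly_cutoff (Suc k) (g x)"

text \<open>The coefficients of index \<open>Suc d\<close> cancel, both products being
  \<open>coeff (g x) k * coeff (f x) (Suc d)\<close>. One division step suffices, because only a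
  drop below \<open>Suc d\<close> is needed.\<close>

lemma poly_family_pseudo_reduce:
  assumes f: "poly_family n (Suc d) f" and g: "poly_family n (Suc d) g" and k: "k \<le> Suc d"
  shows "poly_family n d (pseudo_reduce (Suc d) f g k)"
  unfolding poly_family_def
proof (intro conjI allI)
  have coeff: "coeff (pseudo_reduce (Suc d) f g k x) i = coeff (g x) k * coeff (f x) i -
      (if i < Suc d - k then 0 else if i - (Suc d - k) < Suc k
       then coeff (f x) (Suc d) * coeff (g x) (i - (Suc d - k)) else 0)" for x i
    by (simp add: pseudo_reduce_def coeff_monom_mult coeff_poly_cutoff)
  have pf: "poly_fun n (\<lambda>x. coeff (f x) i)" "poly_fun n (\<lambda>x. coeff (g x) i)" for i
    using f g by (auto simp: poly_family_def)
  show "poly_fun n (\<lambda>x. coeff (pseudo_reduce (Suc d) f g k x) i)" for i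
  proof -
    have "poly_fun n (\<lambda>x. if i < Suc d - k then 0 else if i - (Suc d - k) < Suc k
        then coeff (f x) (Suc d) * coeff (g x) (i - (Suc d - k)) else 0)"
      using pf_const[of n 0] pf_mult[OF pf] by (cases "i < Suc d - k"; cases "i - (Suc d - k) < Suc k") simp_all
    then show ?thesis unfolding coeff by (intro poly_fun_diff pf_mult pf)
  qed
  show "degree (pseudo_reduce (Suc d) f g k x) \<le> d" for x
  proof (rule degree_le, intro allI impI)
    fix i assume "d < i"
    then consider "i = Suc d" | "i > Suc d" by linarith
    then show "coeff (pseudo_reduce (Suc d) f g k x) i = 0"
    proof cases
      case 1
      then show ?thesis using k by (simp add: coeff)
    next
      case 2
      then have "coeff (f x) i = 0" using f by (intro coeff_eq_0) (auto simp: poly_family_def intro: le_less_trans)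
      then show ?thesis using 2 k by (auto simp: coeff)
    qed
  qed
qed

section \<open>Sign-invariant base sets and induction on the formal degree\<close>

definition sgn_invariant :: "'a set \<Rightarrow> ('a \<Rightarrow> real) set \<Rightarrow> bool" where
  "sgn_invariant A G \<longleftrightarrow> (\<forall>g\<in>G. \<forall>x\<in>A. \<forall>y\<in>A. sgn (g x) = sgn (g y))"

lemma sgn_invariantD: "sgn_invariant A G \<Longrightarrow> g \<in> G \<Longrightarrow> x \<in> A \<Longrightarrow> y \<in> A \<Longrightarrow> sgn (g x) = sgn (g y)"
  unfolding sgn_invariant_def by blast

lemma sgn_invariant_eq_0D:
  "sgn_invariant A G \<Longrightarrow> g \<in> G \<Longrightarrow> x \<in> A \<Longrightarrow> y \<in> A \<Longrightarrow> g x = 0 \<longleftrightarrow> g y = 0"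
  by (drule (3) sgn_invariantD) (simp add: sgn_if split: if_splits)

lemma sgn_invariant_subset: "sgn_invariant A G \<Longrightarrow> G' \<subseteq> G \<Longrightarrow> sgn_invariant A G'"
  unfolding sgn_invariant_def by blast

text \<open>\<open>G\<close> is fixed before \<open>A\<close>, so finitely many polynomials control
  all base sets at once.\<close>

definition decomposable :: "nat \<Rightarrow> ((nat \<Rightarrow> real) \<Rightarrow> real poly) set \<Rightarrow> bool" where
  "decomposable n F \<longleftrightarrow> (\<exists>G. finite G \<and> (\<forall>g\<in>G. poly_fun n g) \<and>
     (\<forall>A. sgn_invariant A G \<longrightarrow> (\<exists>\<Xi>. sign_diagram A F \<Xi>)))"

lemma decomposable_constant:
  assumes fin: "finite F" and F: "\<And>f. f \<in> F \<Longrightarrow> poly_family n 0 f"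
  shows "decomposable n F"
  unfolding decomposable_def
proof (rule exI[of _ "(\<lambda>f x. coeff (f x) 0) ` F"], intro conjI allI impI)
  let ?G = "(\<lambda>f x. coeff (f x) 0) ` F"
  show "finite ?G" using fin by simp
  show "\<forall>g\<in>?G. poly_fun n g" using F by (auto simp: poly_family_def)
  fix A assume inv: "sgn_invariant A ?G"
  have const: "f x = [:coeff (f x) 0:]" if "f \<in> F" for f x
    using F[OF that] by (simp add: poly_family_def degree_0_id)
  have poly_const: "poly (f x) t = coeff (f x) 0" if "f \<in> F" for f x t
    using arg_cong[OF const[OF that, of x], of "\<lambda>p. poly p t"] by simp
  have "sign_diagram A F {}"
  proof (rule sign_diagramI)
    show "ordered_sections A {}" by (simp add: ordered_sections_def)
    show "(\<forall>x\<in>A. f x = 0) \<or> (\<forall>x\<in>A. f x \<noteq> 0 \<and> (\<forall>t. poly (f x) t = 0 \<longrightarrow> (\<exists>\<xi>\<in>{}. t = \<xi> x)))"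
      if f: "f \<in> F" for f
    proof (cases "\<exists>x\<in>A. coeff (f x) 0 = 0")
      case True
      then have "coeff (f x) 0 = 0" if "x \<in> A" for x
        using sgn_invariant_eq_0D[OF inv imageI[OF f] that] by auto
      then have "f x = 0" if "x \<in> A" for x
        using const[OF f, of x] that by simp
      then show ?thesis by simp
    next
      case False
      then have "coeff (f x) 0 \<noteq> 0" if "x \<in> A" for x using that by blast
      then have "f x \<noteq> 0" "poly (f x) t \<noteq> 0" if "x \<in> A" for x t
        using that by (force, simp add: poly_const[OF f])
      then show ?thesis by simp
    qed
    fix f x y s t assume f: "f \<in> F" and xy: "x \<in> A" "y \<in> A"
    show "sgn (poly (f x) s) = sgn (poly (f y) t)"
      using sgn_invariantD[OF inv imageI[OF f] xy] by (simp add: poly_const[OF f])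
  qed simp
  then show "\<exists>\<Xi>. sign_diagram A F \<Xi>" by (rule exI)
qed

text \<open>Members are functions on the whole space, so a member and its truncation may be
  different elements although they agree over \<open>A\<close>.\<close>

lemma sign_diagram_cong:
  assumes d: "sign_diagram A (insert f F) \<Xi>" and eq: "\<And>x. x \<in> A \<Longrightarrow> f x = g x"
  shows "sign_diagram A (insert g F) \<Xi>"
proof (rule sign_diagramI)
  show "ordered_sections A \<Xi>" by (rule sign_diagramD(1)[OF d])
  show "(\<forall>x\<in>A. h x = 0) \<or> (\<forall>x\<in>A. h x \<noteq> 0 \<and> (\<forall>t. poly (h x) t = 0 \<longrightarrow> (\<exists>\<xi>\<in>\<Xi>. t = \<xi> x)))"
    if "h \<in> insert g F" for h
  proof (cases "h = g")
    case True
    have "(\<forall>x\<in>A. f x = 0) \<or> (\<forall>x\<in>A. f x \<noteq> 0 \<and> (\<forall>t. poly (f x) t = 0 \<longrightarrow> (\<exists>\<xi>\<in>\<Xi>. t = \<xi> x)))"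
      by (rule sign_diagramD(2)[OF d insertI1])
    then show ?thesis unfolding True by (simp add: eq)
  next
    case False
    then show ?thesis using that by (intro sign_diagramD(2)[OF d]) simp
  qed
  show "\<exists>h\<in>insert g F. \<forall>x\<in>A. h x \<noteq> 0 \<and> poly (h x) (\<xi> x) = 0" if \<xi>: "\<xi> \<in> \<Xi>" for \<xi>
  proof -
    obtain h where h: "h \<in> insert f F" "\<forall>x\<in>A. h x \<noteq> 0 \<and> poly (h x) (\<xi> x) = 0"
      by (rule bexE[OF sign_diagramD(3)[OF d \<xi>]])
    show ?thesis
    proof (cases "h = f")
      case True
      then show ?thesis using h(2) by (intro bexI[of _ g]) (simp_all add: eq)
    next
      case False
      then show ?thesis using h by (intro bexI[of _ h]) simp_all
    qed
  qed
  fix h x y s t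
  assume h: "h \<in> insert g F" and xy: "x \<in> A" "y \<in> A" "same_cell \<Xi> x s y t"
  show "sgn (poly (h x) s) = sgn (poly (h y) t)"
  proof (cases "h = g")
    case True
    then show ?thesis using sign_diagramD(4)[OF d insertI1 xy] xy by (simp add: eq)
  next
    case False
    then show ?thesis using h by (intro sign_diagramD(4)[OF d _ xy]) simp
  qed
qed

text \<open>The larger diagram serves to learn the sign of \<open>f\<close> on the sections of
  \<open>insert f' K\<close>. Such a section is a root of some \<open>g\<close>, whose degree
  \<open>k\<close> is constant over \<open>A\<close> because the signs of its coefficients are.
  There the reduction is \<open>coeff (g x) k\<close> times \<open>f\<close>, and both the reduction
  and this coefficient have constant sign.\<close>

lemma sign_diagram_insert:
  fixes A :: "(nat \<Rightarrow> real) set" and f :: "(nat \<Rightarrow> real) \<Rightarrow> real poly"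
  defines "f' \<equiv> \<lambda>x. pderiv (f x)"
  assumes f: "poly_family n (Suc d) f" and K: "\<And>g. g \<in> K \<Longrightarrow> poly_family n (Suc d) g"
    and K_inv: "sgn_invariant A ((\<lambda>(g, k) x. coeff (g x) k) ` (insert f (insert f' K) \<times> {..Suc d}))"
    and lead: "\<And>x. x \<in> A \<Longrightarrow> coeff (f x) (Suc d) \<noteq> 0"
    and d: "sign_diagram A
      (insert f' K \<union> (\<lambda>(g, k). pseudo_reduce (Suc d) f g k) ` (insert f' K \<times> {1..Suc d})) \<Xi>2"
      (is "sign_diagram A (_ \<union> ?R) _")
  shows "\<exists>\<Xi>. sign_diagram A (insert f K) \<Xi>"
proof -
  have f': "poly_family n (Suc d) f'"
    using poly_family_mono[OF poly_family_pderiv[OF f]] by (simp add: f'_def)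
  have deg: "degree (f x) = Suc d" if "x \<in> A" for x
    using f lead[OF that] by (intro antisym le_degree) (auto simp: poly_family_def)
  \<comment> \<open>Sections needed only for the remainders are discarded first: on them nothing is
    known about the sign of \<open>f\<close>.\<close>
  obtain \<Xi> where \<Xi>: "\<Xi> \<subseteq> \<Xi>2" "sign_diagram A (insert f' K) \<Xi>"
    using sign_diagram_subset[OF d, of "insert f' K"] by blast
  have coeff_sgn: "sgn (coeff (g x) k) = sgn (coeff (g y) k)"
    if "g \<in> insert f (insert f' K)" "k \<le> Suc d" "x \<in> A" "y \<in> A" for g k x y
    by (rule sgn_invariantD[OF K_inv image_eqI[of _ _ "(g, k)"] that(3,4)]) (use that in simp_all)
  have section_sgn: "sgn (poly (f x) (\<xi> x)) = sgn (poly (f y) (\<xi> y))"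
    if \<xi>: "\<xi> \<in> \<Xi>" and x: "x \<in> A" and y: "y \<in> A" for \<xi> x y
  proof -
    obtain g where g: "g \<in> insert f' K" "\<forall>x\<in>A. g x \<noteq> 0 \<and> poly (g x) (\<xi> x) = 0"
      using sign_diagramD(3)[OF \<Xi>(2) \<xi>] by blast
    have deg_le: "degree (g z) \<le> Suc d" for z using g(1) f' K by (auto simp: poly_family_def)
    define k where "k = degree (g x)"
    have coeff_0: "coeff (g y) i = 0 \<longleftrightarrow> coeff (g x) i = 0" for i
    proof (cases "i \<le> Suc d")
      case True
      then show ?thesis using coeff_sgn[of g i x y] g(1) x y by (metis insertCI sgn_zero_iff)
    next
      case False
      then have "degree (g z) < i" for z using deg_le[of z] by simp
      then show ?thesis by (simp add: coeff_eq_0)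
    qed
    have ky: "degree (g y) = k"
    proof (rule antisym)
      show "degree (g y) \<le> k" by (rule degree_le) (simp add: coeff_0 k_def coeff_eq_0)
      show "k \<le> degree (g y)"
        using g(2) x by (intro le_degree) (simp add: coeff_0 k_def)
    qed
    \<comment> \<open>A nonzero constant has no root; hence the reductions are indexed from
      1.\<close>
    have k1: "k \<noteq> 0"
    proof
      assume "k = 0"
      then obtain c where "g x = [:c:]" unfolding k_def by (metis degree_eq_zeroE)
      then show False using g(2) x by auto
    qed
    have k: "k \<in> {1..Suc d}" using k1 deg_le[of x] by (simp add: k_def)
    have red: "poly (pseudo_reduce (Suc d) f g k z) (\<xi> z) = coeff (g z) k * poly (f z) (\<xi> z)"
      if "z \<in> A" "degree (g z) = k" for z
    proof -
      have "poly_cutoff (Suc k) (g z) = g z"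
        by (rule poly_eqI) (use that in \<open>simp add: coeff_poly_cutoff coeff_eq_0\<close>)
      then show ?thesis using g(2) that(1) by (simp add: pseudo_reduce_def)
    qed
    have "pseudo_reduce (Suc d) f g k \<in> ?R"
      using g(1) k by (intro image_eqI[of _ _ "(g, k)"]) auto
    then have "sgn (poly (pseudo_reduce (Suc d) f g k x) (\<xi> x)) = sgn (poly (pseudo_reduce (Suc d) f g k y) (\<xi> y))"
      using \<Xi>(1) \<xi> x y by (intro sign_diagramD(4)[OF d] section_same_cell[OF sign_diagramD(1)[OF d]]) auto
    then have "sgn (coeff (g x) k) * sgn (poly (f x) (\<xi> x)) = sgn (coeff (g y) k) * sgn (poly (f y) (\<xi> y))"
      using red[OF x] red[OF y] ky by (simp add: k_def sgn_mult)
    moreover have "sgn (coeff (g y) k) = sgn (coeff (g x) k)"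
      using g(1) k x y by (intro coeff_sgn) auto
    moreover have "sgn (coeff (g x) k) \<noteq> 0" using g(2) x by (simp add: k_def sgn_zero_iff)
    ultimately show ?thesis by simp
  qed
  interpret section_insertion A \<Xi> f "Suc d"
  proof
    show "ordered_sections A \<Xi>" by (rule sign_diagramD(1)[OF \<Xi>(2)])
    show "continuous_on A (\<lambda>x. poly (f x) t)" for t by (rule continuous_poly_family[OF f])
    show "degree (f x) = Suc d" if "x \<in> A" for x by (rule deg[OF that])
    show "f x \<noteq> 0" if "x \<in> A" for x using lead[OF that] by auto
    show "sgn (lead_coeff (f x)) = sgn (lead_coeff (f y))" if "x \<in> A" "y \<in> A" for x y
      using coeff_sgn[of f "Suc d" x y] that deg by simp
    show "\<exists>\<xi>\<in>\<Xi>. t = \<xi> x" if "x \<in> A" "poly (pderiv (f x)) t = 0" for x t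
    proof -
      have "f' x \<noteq> 0" using deg[OF that(1)] by (simp add: f'_def pderiv_eq_0_iff)
      then show ?thesis using sign_diagramD(2)[OF \<Xi>(2), of f'] that by (auto simp: f'_def)
    qed
    show "sgn (poly (pderiv (f x)) s) = sgn (poly (pderiv (f y)) t)"
      if "x \<in> A" "y \<in> A" "same_cell \<Xi> x s y t" for x y s t
      using sign_diagramD(4)[OF \<Xi>(2), of f' x y s t] that by (simp add: f'_def)
    show "sgn (poly (f x) (\<xi> x)) = sgn (poly (f y) (\<xi> y))" if "\<xi> \<in> \<Xi>" "x \<in> A" "y \<in> A" for \<xi> x y
      by (rule section_sgn[OF that])
  qed
  obtain \<Xi>' where sub: "\<Xi> \<subseteq> \<Xi>'" and os': "ordered_sections A \<Xi>'"
    and new: "\<forall>\<xi>\<in>\<Xi>' - \<Xi>. \<forall>x\<in>A. poly (f x) (\<xi> x) = 0"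
    and roots: "\<forall>x\<in>A. \<forall>t. poly (f x) t = 0 \<longrightarrow> (\<exists>\<xi>\<in>\<Xi>'. t = \<xi> x)"
    and sg: "\<forall>x\<in>A. \<forall>y\<in>A. \<forall>s t. same_cell \<Xi>' x s y t \<longrightarrow> sgn (poly (f x) s) = sgn (poly (f y) t)"
    using insert_root_sections by (elim exE conjE)
  have "sign_diagram A (insert f (insert f' K)) \<Xi>'"
  proof (rule sign_diagramI[OF os'])
    show "(\<forall>x\<in>A. g x = 0) \<or> (\<forall>x\<in>A. g x \<noteq> 0 \<and> (\<forall>t. poly (g x) t = 0 \<longrightarrow> (\<exists>\<xi>\<in>\<Xi>'. t = \<xi> x)))"
      if g: "g \<in> insert f (insert f' K)" for g
    proof (cases "g = f")
      case True
      then show ?thesis using roots nonzero by simp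
    next
      case False
      then have "g \<in> insert f' K" using g by simp
      from sign_diagramD(2)[OF \<Xi>(2) this] show ?thesis using sub by blast
    qed
    show "\<exists>g\<in>insert f (insert f' K). \<forall>x\<in>A. g x \<noteq> 0 \<and> poly (g x) (\<xi> x) = 0" if \<xi>: "\<xi> \<in> \<Xi>'" for \<xi>
    proof (cases "\<xi> \<in> \<Xi>")
      case True
      then show ?thesis using sign_diagramD(3)[OF \<Xi>(2) True] by blast
    next
      case False
      then show ?thesis using new \<xi> nonzero by simp
    qed
    show "sgn (poly (g x) s) = sgn (poly (g y) t)"
      if "g \<in> insert f (insert f' K)" "x \<in> A" "y \<in> A" "same_cell \<Xi>' x s y t" for g x y s t
    proof (cases "g = f")
      case True
      then show ?thesis using sg that by simp
    next
      case False
      then show ?thesis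
        using that by (intro sign_diagramD(4)[OF \<Xi>(2)] same_cell_mono[OF that(4) sub]) simp_all
    qed
  qed
  \<comment> \<open>The auxiliary derivative leaves the family, together with sections that only it
    needed.\<close>
  from sign_diagram_subset[OF this, of "insert f K"] show ?thesis by blast
qed

text \<open>The coefficients in \<open>?C\<close> join the controlling polynomials, so the top
  coefficient of \<open>f\<close> vanishes everywhere or nowhere on \<open>A\<close>. In the first
  case \<open>f\<close> agrees with its truncation; in the second \<open>sign_diagram_insert\<close>
  applies.\<close>

lemma decomposable_insert:
  fixes f :: "(nat \<Rightarrow> real) \<Rightarrow> real poly"
  defines "f' \<equiv> \<lambda>x. pderiv (f x)"
  assumes f: "poly_family n (Suc d) f" and K: "\<And>g. g \<in> K \<Longrightarrow> poly_family n (Suc d) g" and fin: "finite K"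
    and 1: "decomposable n (insert (\<lambda>x. poly_cutoff (Suc d) (f x)) K)"
    and 2: "decomposable n (insert f' K \<union> (\<lambda>(g, k). pseudo_reduce (Suc d) f g k) ` (insert f' K \<times> {1..Suc d}))"
  shows "decomposable n (insert f K)"
proof -
  let ?C = "(\<lambda>(g, k) x. coeff (g x) k) ` (insert f (insert f' K) \<times> {..Suc d})"
  obtain G1 where G1: "finite G1" "\<forall>g\<in>G1. poly_fun n g"
    "\<And>A. sgn_invariant A G1 \<Longrightarrow> \<exists>\<Xi>. sign_diagram A (insert (\<lambda>x. poly_cutoff (Suc d) (f x)) K) \<Xi>"
    using 1 unfolding decomposable_def by blast
  obtain G2 where G2: "finite G2" "\<forall>g\<in>G2. poly_fun n g"
    "\<And>A. sgn_invariant A G2 \<Longrightarrow> \<exists>\<Xi>. sign_diagram A (insert f' K \<union>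
      (\<lambda>(g, k). pseudo_reduce (Suc d) f g k) ` (insert f' K \<times> {1..Suc d})) \<Xi>"
    using 2 unfolding decomposable_def by blast
  have f': "poly_family n (Suc d) f'"
    using poly_family_mono[OF poly_family_pderiv[OF f]] by (simp add: f'_def)
  have "\<exists>\<Xi>. sign_diagram A (insert f K) \<Xi>" if inv: "sgn_invariant A (G1 \<union> G2 \<union> ?C)" for A
  proof (cases "\<exists>x\<in>A. coeff (f x) (Suc d) = 0")
    case True
    have lead_in: "(\<lambda>x. coeff (f x) (Suc d)) \<in> G1 \<union> G2 \<union> ?C" by force
    have "poly_cutoff (Suc d) (f x) = f x" if "x \<in> A" for x
    proof (rule poly_eqI)
      have "coeff (f x) (Suc d) = 0"
        using True sgn_invariant_eq_0D[OF inv lead_in _ that] by blast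
      moreover have "coeff (f x) i = 0" if "i > Suc d" for i
        using f that by (intro coeff_eq_0) (auto simp: poly_family_def intro: le_less_trans)
      ultimately show "coeff (poly_cutoff (Suc d) (f x)) i = coeff (f x) i" for i
        by (cases i "Suc d" rule: linorder_cases) (auto simp: coeff_poly_cutoff)
    qed
    moreover obtain \<Xi> where "sign_diagram A (insert (\<lambda>x. poly_cutoff (Suc d) (f x)) K) \<Xi>"
      using G1(3)[OF sgn_invariant_subset[OF inv]] by blast
    ultimately show ?thesis using sign_diagram_cong by blast
  next
    case False
    obtain \<Xi> where d: "sign_diagram A (insert f' K \<union>
        (\<lambda>(g, k). pseudo_reduce (Suc d) f g k) ` (insert f' K \<times> {1..Suc d})) \<Xi>"
      using G2(3)[OF sgn_invariant_subset[OF inv]] by blast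
    have C: "sgn_invariant A ?C" by (rule sgn_invariant_subset[OF inv]) simp
    show ?thesis
      using False sign_diagram_insert[OF f K C[unfolded f'_def] _ d[unfolded f'_def]] by blast
  qed
  moreover have "finite (G1 \<union> G2 \<union> ?C)" using G1(1) G2(1) fin by simp
  moreover have "\<forall>g\<in>G1 \<union> G2 \<union> ?C. poly_fun n g"
    using G1(2) G2(2) f f' K by (auto simp: poly_family_def)
  ultimately show ?thesis
    unfolding decomposable_def by (intro exI[of _ "G1 \<union> G2 \<union> ?C"]) simp
qed

text \<open>Inside the induction on \<open>d\<close>, a second one runs over the set
  \<open>H\<close> of members of top formal degree. The rest \<open>F0\<close> stays arbitrary
  there, since it absorbs whatever replaces a member of \<open>H\<close>: its truncation, or its
  derivative and remainders.\<close>

theorem decomposable_finite: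
  assumes "finite F" "\<And>f. f \<in> F \<Longrightarrow> poly_family n d f"
  shows "decomposable n F"
  using assms
proof (induction d arbitrary: F)
  case 0
  then show ?case by (rule decomposable_constant)
next
  case (Suc d)
  have "decomposable n (F0 \<union> H)"
    if "finite H" "\<forall>f\<in>H. poly_family n (Suc d) f" "finite F0" "\<forall>f\<in>F0. poly_family n d f" for F0 H
    using that
  proof (induction H arbitrary: F0 rule: finite_induct)
    case empty
    then show ?case using Suc.IH[of F0] by simp
  next
    case (insert f H)
    let ?f' = "\<lambda>x. pderiv (f x)"
    let ?K = "F0 \<union> H"
    let ?R = "(\<lambda>(g, k). pseudo_reduce (Suc d) f g k) ` (insert ?f' ?K \<times> {1..Suc d})"
    have f: "poly_family n (Suc d) f" using insert.prems by simp
    have f': "poly_family n d ?f'" by (rule poly_family_pderiv[OF f])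
    have K: "poly_family n (Suc d) g" if "g \<in> ?K" for g
      using that insert.prems poly_family_mono[of n d g "Suc d"] by auto
    have finK: "finite ?K" using insert.hyps insert.prems by simp
    have "decomposable n (insert (\<lambda>x. poly_cutoff (Suc d) (f x)) F0 \<union> H)"
      using insert.prems poly_family_cutoff[OF f] by (intro insert.IH) auto
    then have 1: "decomposable n (insert (\<lambda>x. poly_cutoff (Suc d) (f x)) ?K)" by simp
    have R: "poly_family n d r" if "r \<in> ?R" for r
      using that K poly_family_mono[OF f', of "Suc d"] by (auto intro!: poly_family_pseudo_reduce[OF f])
    have "decomposable n ((insert ?f' F0 \<union> ?R) \<union> H)"
      using insert.prems f' R finK by (intro insert.IH) auto
    moreover have "(insert ?f' F0 \<union> ?R) \<union> H = insert ?f' ?K \<union> ?R" by auto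
    ultimately have 2: "decomposable n (insert ?f' ?K \<union> ?R)" by simp
    from decomposable_insert[OF f K finK 1 2] show ?case by simp
  qed
  from this[of F "{}"] show ?case using Suc.prems by simp
qed

section \<open>Semialgebraic sets\<close>

lemma poly_fun_Suc_family:
  assumes "poly_fun (Suc n) p"
  shows "\<exists>P d. poly_family n d P \<and> (\<forall>x t. p (x(n := t)) = poly (P x) t)"
  using assms
proof induction
  case (pf_const c)
  have "poly_family n 0 (\<lambda>x. [:c:])"
    unfolding poly_family_def
  proof (intro conjI allI)
    show "poly_fun n (\<lambda>x. coeff [:c:] i)" for i by (rule poly_fun.pf_const)
  qed simp
  then show ?case by (intro exI[of _ "\<lambda>x. [:c:]"] exI[of _ 0]) simp
next
  case (pf_var i)
  show ?case
  proof (cases "i = n")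
    case True
    have "poly_family n 1 (\<lambda>x. [:0, 1:])"
      unfolding poly_family_def
    proof (intro conjI allI)
      show "poly_fun n (\<lambda>x. coeff [:0, 1:] i)" for i by (rule poly_fun.pf_const)
    qed simp
    then show ?thesis using True by (intro exI[of _ "\<lambda>x. [:0, 1:]"] exI[of _ 1]) simp
  next
    case False
    then have i: "i < n" using pf_var by simp
    have "poly_family n 0 (\<lambda>x. [:x i:])"
      unfolding poly_family_def
    proof (intro conjI allI)
      show "poly_fun n (\<lambda>x. coeff [:x i:] j)" for j
        using poly_fun.pf_var[OF i] poly_fun.pf_const[of n 0] by (cases j) simp_all
    qed simp
    then show ?thesis using i by (intro exI[of _ "\<lambda>x. [:x i:]"] exI[of _ 0]) simp
  qed
next
  case (pf_add p q)
  then obtain P d Q e where P: "poly_family n d P" "\<forall>x t. p (x(n := t)) = poly (P x) t"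
    and Q: "poly_family n e Q" "\<forall>x t. q (x(n := t)) = poly (Q x) t" by (elim exE conjE)
  have "poly_family n (max d e) (\<lambda>x. P x + Q x)"
    unfolding poly_family_def
  proof (intro conjI allI)
    show "poly_fun n (\<lambda>x. coeff (P x + Q x) i)" for i
      unfolding coeff_add by (rule poly_fun.pf_add) (use P Q in \<open>simp_all add: poly_family_def\<close>)
    show "degree (P x + Q x) \<le> max d e" for x
      by (rule degree_add_le) (use P(1) Q(1) in \<open>simp_all add: poly_family_def le_max_iff_disj\<close>)
  qed
  then show ?case
    using P Q by (intro exI[of _ "\<lambda>x. P x + Q x"] exI[of _ "max d e"]) (simp del: fun_upd_apply)
next
  case (pf_mult p q)
  then obtain P d Q e where P: "poly_family n d P" "\<forall>x t. p (x(n := t)) = poly (P x) t"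
    and Q: "poly_family n e Q" "\<forall>x t. q (x(n := t)) = poly (Q x) t" by (elim exE conjE)
  have "poly_family n (d + e) (\<lambda>x. P x * Q x)"
    unfolding poly_family_def
  proof (intro conjI allI)
    show "poly_fun n (\<lambda>x. coeff (P x * Q x) i)" for i
      unfolding coeff_mult
    proof (rule poly_fun_sum)
      show "poly_fun n (\<lambda>x. coeff (P x) j * coeff (Q x) (i - j))" for j
        by (rule poly_fun.pf_mult) (use P Q in \<open>simp_all add: poly_family_def\<close>)
    qed simp
    show "degree (P x * Q x) \<le> d + e" for x
      using P(1) Q(1) degree_mult_le[of "P x" "Q x"]
      unfolding poly_family_def by (meson add_mono order_trans)
  qed
  then show ?case
    using P Q by (intro exI[of _ "\<lambda>x. P x * Q x"] exI[of _ "d + e"]) (simp del: fun_upd_apply)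
qed

lemma cylindrical_projection:
  assumes fin: "finite F" and F: "\<forall>f\<in>F. poly_fun (Suc n) f"
  shows "\<exists>G P. finite G \<and> (\<forall>g\<in>G. poly_fun n g) \<and>
    (\<forall>f\<in>F. \<forall>x t. f (x(n := t)) = poly (P f x) t) \<and>
    (\<forall>A. sgn_invariant A G \<longrightarrow> (\<exists>\<Xi>. sign_diagram A (P ` F) \<Xi>))"
proof -
  have "\<forall>f\<in>F. \<exists>P d. poly_family n d P \<and> (\<forall>x t. f (x(n := t)) = poly (P x) t)"
    using poly_fun_Suc_family F by blast
  from bchoice[OF this] obtain P where
    "\<forall>f\<in>F. \<exists>d. poly_family n d (P f) \<and> (\<forall>x t. f (x(n := t)) = poly (P f x) t)" by (rule exE)
  from bchoice[OF this] obtain d where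
    d: "\<forall>f\<in>F. poly_family n (d f) (P f) \<and> (\<forall>x t. f (x(n := t)) = poly (P f x) t)" by (rule exE)
  have "decomposable n (P ` F)"
  proof (rule decomposable_finite)
    show "finite (P ` F)" using fin by simp
    fix p assume "p \<in> P ` F"
    then obtain f where f: "f \<in> F" "p = P f" by blast
    \<comment> \<open>The sum is merely a common bound for the individual degrees.\<close>
    have "d f \<le> sum d F" using fin f(1) by (intro member_le_sum) simp_all
    then show "poly_family n (sum d F) p" using d f poly_family_mono by blast
  qed
  then obtain G where "finite G" "\<forall>g\<in>G. poly_fun n g"
    "\<forall>A. sgn_invariant A G \<longrightarrow> (\<exists>\<Xi>. sign_diagram A (P ` F) \<Xi>)"
    unfolding decomposable_def by (elim exE conjE)
  then show ?thesis using d by (intro exI[of _ G] exI[of _ P]) simp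
qed

text \<open>A class is determined by a function from \<open>F\<close> to \<open>{- 1, 0, 1}\<close>.
  \<open>h\<close> is general because the same count serves sign classes of polynomials and cells of
  a cylinder.\<close>

lemma finite_sgn_classes:
  fixes h :: "'f \<Rightarrow> 'a \<Rightarrow> real"
  assumes "finite F"
  shows "finite ((\<lambda>y. {x\<in>X. \<forall>f\<in>F. sgn (h f x) = sgn (h f y)}) ` Y)"
proof -
  let ?V = "(\<lambda>y. restrict (\<lambda>f. sgn (h f y)) F) ` Y"
  have "?V \<subseteq> PiE F (\<lambda>_. {- 1, 0, 1})" by (auto simp: sgn_if split: if_splits)
  then have "finite ?V" by (rule finite_subset) (simp add: finite_PiE assms)
  moreover have "(\<lambda>y. {x\<in>X. \<forall>f\<in>F. sgn (h f x) = sgn (h f y)}) ` Y = (\<lambda>v. {x\<in>X. \<forall>f\<in>F. sgn (h f x) = v f}) ` ?V"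
    by (simp add: image_image)
  ultimately show ?thesis by simp
qed

lemma semialgebraic_subset: "semialgebraic n S \<Longrightarrow> S \<subseteq> Rn n"
  by (induction rule: semialgebraic.induct) auto

text \<open>A substitute for disjunctive normal forms: being a union of sign classes passes through
  unions, intersections and complements once the finite sets of polynomials are merged. The converse
  is \<open>sign_determined_imp_semialgebraic\<close>.\<close>

lemma semialgebraic_imp_sign_determined:
  assumes "semialgebraic n S"
  shows "\<exists>F. finite F \<and> (\<forall>f\<in>F. poly_fun n f) \<and>
    (\<forall>x\<in>Rn n. \<forall>y\<in>Rn n. (\<forall>f\<in>F. sgn (f x) = sgn (f y)) \<longrightarrow> (x \<in> S \<longleftrightarrow> y \<in> S))"
  using assms
proof induction
  case (sa_zero p)
  have "p x = 0 \<longleftrightarrow> p y = 0" if "sgn (p x) = sgn (p y)" for x y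
    using that by (auto simp: sgn_if split: if_splits)
  note * = this
  show ?case
  proof (intro exI[of _ "{p}"] conjI ballI impI)
    show "poly_fun n f" if "f \<in> {p}" for f using that sa_zero by simp
    fix x y assume xy: "x \<in> Rn n" "y \<in> Rn n" and "\<forall>f\<in>{p}. sgn (f x) = sgn (f y)"
    then have "p x = 0 \<longleftrightarrow> p y = 0" by (intro *) simp
    then show "x \<in> {x\<in>Rn n. p x = 0} \<longleftrightarrow> y \<in> {x\<in>Rn n. p x = 0}"
      using xy by simp
  qed simp
next
  case (sa_pos p)
  have "p x > 0 \<longleftrightarrow> p y > 0" if "sgn (p x) = sgn (p y)" for x y
    using that by (auto simp: sgn_if split: if_splits)
  note * = this
  show ?case
  proof (intro exI[of _ "{p}"] conjI ballI impI)
    show "poly_fun n f" if "f \<in> {p}" for f using that sa_pos by simp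
    fix x y assume xy: "x \<in> Rn n" "y \<in> Rn n" and "\<forall>f\<in>{p}. sgn (f x) = sgn (f y)"
    then have "p x > 0 \<longleftrightarrow> p y > 0" by (intro *) simp
    then show "x \<in> {x\<in>Rn n. p x > 0} \<longleftrightarrow> y \<in> {x\<in>Rn n. p x > 0}"
      using xy by simp
  qed simp
next
  case (sa_union A B)
  then obtain F G where F: "finite F" "\<forall>f\<in>F. poly_fun n f"
      "\<forall>x\<in>Rn n. \<forall>y\<in>Rn n. (\<forall>f\<in>F. sgn (f x) = sgn (f y)) \<longrightarrow> (x \<in> A \<longleftrightarrow> y \<in> A)"
    and G: "finite G" "\<forall>f\<in>G. poly_fun n f"
      "\<forall>x\<in>Rn n. \<forall>y\<in>Rn n. (\<forall>f\<in>G. sgn (f x) = sgn (f y)) \<longrightarrow> (x \<in> B \<longleftrightarrow> y \<in> B)"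
    by (elim exE conjE)
  have "x \<in> A \<union> B \<longleftrightarrow> y \<in> A \<union> B" if "x \<in> Rn n" "y \<in> Rn n" "\<forall>f\<in>F \<union> G. sgn (f x) = sgn (f y)" for x y
    using F(3)[rule_format, OF that(1,2)] G(3)[rule_format, OF that(1,2)] that(3) by simp
  moreover have "finite (F \<union> G)" "\<And>f. f \<in> F \<union> G \<Longrightarrow> poly_fun n f" using F(1,2) G(1,2) by auto
  ultimately show ?case by (intro exI[of _ "F \<union> G"] conjI ballI impI)
next
  case (sa_inter A B)
  then obtain F G where F: "finite F" "\<forall>f\<in>F. poly_fun n f"
      "\<forall>x\<in>Rn n. \<forall>y\<in>Rn n. (\<forall>f\<in>F. sgn (f x) = sgn (f y)) \<longrightarrow> (x \<in> A \<longleftrightarrow> y \<in> A)"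
    and G: "finite G" "\<forall>f\<in>G. poly_fun n f"
      "\<forall>x\<in>Rn n. \<forall>y\<in>Rn n. (\<forall>f\<in>G. sgn (f x) = sgn (f y)) \<longrightarrow> (x \<in> B \<longleftrightarrow> y \<in> B)"
    by (elim exE conjE)
  have "x \<in> A \<inter> B \<longleftrightarrow> y \<in> A \<inter> B" if "x \<in> Rn n" "y \<in> Rn n" "\<forall>f\<in>F \<union> G. sgn (f x) = sgn (f y)" for x y
    using F(3)[rule_format, OF that(1,2)] G(3)[rule_format, OF that(1,2)] that(3) by simp
  moreover have "finite (F \<union> G)" "\<And>f. f \<in> F \<union> G \<Longrightarrow> poly_fun n f" using F(1,2) G(1,2) by auto
  ultimately show ?case by (intro exI[of _ "F \<union> G"] conjI ballI impI)
next
  case (sa_compl A)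
  then obtain F where F: "finite F" "\<forall>f\<in>F. poly_fun n f"
      "\<forall>x\<in>Rn n. \<forall>y\<in>Rn n. (\<forall>f\<in>F. sgn (f x) = sgn (f y)) \<longrightarrow> (x \<in> A \<longleftrightarrow> y \<in> A)"
    by (elim exE conjE)
  have "x \<in> Rn n - A \<longleftrightarrow> y \<in> Rn n - A" if "x \<in> Rn n" "y \<in> Rn n" "\<forall>f\<in>F. sgn (f x) = sgn (f y)" for x y
    using F(3)[rule_format, OF that(1,2)] that by simp
  then show ?case using F(1) F(2)[rule_format] by (intro exI[of _ F] conjI ballI impI)
qed

lemma semialgebraic_Rn: "semialgebraic n (Rn n)"
  using sa_zero[OF pf_const[of n 0]] by simp

lemma semialgebraic_empty: "semialgebraic n {}"
  using sa_compl[OF semialgebraic_Rn] by simp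

lemma semialgebraic_Union:
  assumes "finite \<S>" "\<And>S. S \<in> \<S> \<Longrightarrow> semialgebraic n S"
  shows "semialgebraic n (\<Union>\<S>)"
  using assms by (induction \<S> rule: finite_induct) (simp_all add: semialgebraic_empty sa_union)

lemma semialgebraic_sgn_class:
  assumes "finite F" "\<And>f. f \<in> F \<Longrightarrow> poly_fun n f"
  shows "semialgebraic n {x\<in>Rn n. \<forall>f\<in>F. sgn (f x) = sgn (f y)}"
  using assms
proof (induction F rule: finite_induct)
  case empty
  then show ?case by (simp add: semialgebraic_Rn)
next
  case (insert f F)
  have f: "poly_fun n f" using insert.prems by simp
  have "semialgebraic n {x\<in>Rn n. sgn (f x) = sgn (f y)}"
  proof (cases "f y" "0::real" rule: linorder_cases)
    case less
    then have "{x\<in>Rn n. sgn (f x) = sgn (f y)} = {x\<in>Rn n. 0 - f x > 0}"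
      by (auto simp: sgn_if split: if_splits)
    then show ?thesis using sa_pos[OF poly_fun_diff[OF pf_const[of n 0] f]] by simp
  next
    case equal
    then have "{x\<in>Rn n. sgn (f x) = sgn (f y)} = {x\<in>Rn n. f x = 0}"
      by (auto simp: sgn_if split: if_splits)
    then show ?thesis using sa_zero[OF f] by simp
  next
    case greater
    then have "{x\<in>Rn n. sgn (f x) = sgn (f y)} = {x\<in>Rn n. f x > 0}"
      by (auto simp: sgn_if split: if_splits)
    then show ?thesis using sa_pos[OF f] by simp
  qed
  moreover have "semialgebraic n {x\<in>Rn n. \<forall>f\<in>F. sgn (f x) = sgn (f y)}"
    using insert by simp
  moreover have "{x\<in>Rn n. \<forall>f\<in>insert f F. sgn (f x) = sgn (f y)} =
      {x\<in>Rn n. sgn (f x) = sgn (f y)} \<inter> {x\<in>Rn n. \<forall>f\<in>F. sgn (f x) = sgn (f y)}"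
    by blast
  ultimately show ?case by (simp add: sa_inter)
qed

lemma sign_determined_imp_semialgebraic:
  assumes S: "S \<subseteq> Rn n" and fin: "finite F" and F: "\<And>f. f \<in> F \<Longrightarrow> poly_fun n f"
    and det: "\<And>x y. x \<in> Rn n \<Longrightarrow> y \<in> S \<Longrightarrow> \<forall>f\<in>F. sgn (f x) = sgn (f y) \<Longrightarrow> x \<in> S"
  shows "semialgebraic n S"
proof -
  let ?C = "\<lambda>y. {x\<in>Rn n. \<forall>f\<in>F. sgn (f x) = sgn (f y)}"
  have "semialgebraic n (\<Union>(?C ` S))"
  proof (rule semialgebraic_Union)
    show "finite (?C ` S)" by (rule finite_sgn_classes[OF fin, of "Rn n" "\<lambda>f. f"])
    show "semialgebraic n T" if "T \<in> ?C ` S" for T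
      using that semialgebraic_sgn_class[OF fin F] by auto
  qed
  moreover have "\<Union>(?C ` S) = S" using S det by blast
  ultimately show ?thesis by simp
qed

section \<open>Elimination of a quantifier over the last coordinate\<close>

lemma Rn_upd: "x \<in> Rn n \<Longrightarrow> x(n := t) \<in> Rn (Suc n)"
  by (simp add: Rn_def)

lemma Rn_upd_0: "z \<in> Rn (Suc n) \<Longrightarrow> z(n := 0) \<in> Rn n"
  by (auto simp: Rn_def le_Suc_eq)

text \<open>The Tarski-Seidenberg theorem. If \<open>x\<close> and \<open>y\<close> have the same
  signs under \<open>G\<close>, a witness over \<open>y\<close> moves to a point of the same cell
  over \<open>x\<close>, where the polynomials of \<open>F\<close> have the same signs.\<close>

theorem semialgebraic_projection:
  assumes "semialgebraic (Suc n) S"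
  shows "semialgebraic n {x\<in>Rn n. \<exists>t. x(n := t) \<in> S}"
proof -
  obtain F where F: "finite F" "\<forall>f\<in>F. poly_fun (Suc n) f"
      "\<forall>x\<in>Rn (Suc n). \<forall>y\<in>Rn (Suc n). (\<forall>f\<in>F. sgn (f x) = sgn (f y)) \<longrightarrow> (x \<in> S \<longleftrightarrow> y \<in> S)"
    using semialgebraic_imp_sign_determined[OF assms] by (elim exE conjE)
  obtain G P where G: "finite G" "\<forall>g\<in>G. poly_fun n g"
    and P: "\<forall>f\<in>F. \<forall>x t. f (x(n := t)) = poly (P f x) t"
    and diag: "\<forall>A. sgn_invariant A G \<longrightarrow> (\<exists>\<Xi>. sign_diagram A (P ` F) \<Xi>)"
    using cylindrical_projection[OF F(1,2)] by (elim exE conjE)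
  show ?thesis
  proof (rule sign_determined_imp_semialgebraic[of _ n G])
    fix x y
    assume x: "x \<in> Rn n" and "y \<in> {x\<in>Rn n. \<exists>t. x(n := t) \<in> S}"
      and eq: "\<forall>g\<in>G. sgn (g x) = sgn (g y)"
    then obtain t where y: "y \<in> Rn n" and t: "y(n := t) \<in> S" by blast
    \<comment> \<open>Two points form an admissible base set, since no connectedness is
      required.\<close>
    have "sgn_invariant {x, y} G" using eq by (simp add: sgn_invariant_def)
    then obtain \<Xi> where \<Xi>: "sign_diagram {x, y} (P ` F) \<Xi>" using diag by blast
    obtain s where s: "same_cell \<Xi> y t x s"
      using cell_transfer[OF sign_diagramD(1)[OF \<Xi>], of y x t] by blast
    have "sgn (f (y(n := t))) = sgn (f (x(n := s)))" if "f \<in> F" for f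
      using sign_diagramD(4)[OF \<Xi> imageI[OF that] _ _ s] P that by simp
    then have "x(n := s) \<in> S"
      using F(3)[rule_format, OF Rn_upd[OF y, of t] Rn_upd[OF x, of s]] t by simp
    then show "x \<in> {x\<in>Rn n. \<exists>t. x(n := t) \<in> S}" using x by blast
  qed (use G in auto)
qed

text \<open>Two points are joined by moving within their fibres, which are intervals, to the
  continuous selection \<open>m\<close>, and along its graph over \<open>A\<close>.\<close>

lemma path_connected_cell:
  fixes A :: "(nat \<Rightarrow> real) set"
  assumes os: "ordered_sections A \<Xi>" and A: "path_connected A" and x0: "x0 \<in> A"
  shows "path_connected {z. \<exists>x\<in>A. \<exists>t. z = x(n := t) \<and> same_cell \<Xi> x0 s x t}"
    (is "path_connected ?C")
proof -
  obtain m where m: "continuous_on A m" "\<forall>x\<in>A. same_cell \<Xi> x0 s x (m x)"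
    using cell_section[OF os x0, of s] by (elim exE conjE)
  have "continuous_on A (\<lambda>x. x(n := m x))"
  proof (rule continuous_on_coordinatewise_then_product)
    have "continuous_on A (\<lambda>x. x i)" for i :: nat
      by (rule continuous_on_subset[OF continuous_on_product_coordinates]) simp
    then show "continuous_on A (\<lambda>x. (x(n := m x)) i)" for i
      using m(1) by (cases "i = n") simp_all
  qed
  then have "path_connected ((\<lambda>x. x(n := m x)) ` A)"
    using A by (rule path_connected_continuous_image)
  moreover have "(\<lambda>x. x(n := m x)) ` A \<subseteq> ?C" using m(2) by blast
  ultimately have graph: "path_component ?C (x(n := m x)) (y(n := m y))" if "x \<in> A" "y \<in> A" for x y
    using that path_component_of_subset unfolding path_connected_component by blast
  have fibre: "path_component ?C (x(n := t)) (x(n := u))"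
    if x: "x \<in> A" and t: "same_cell \<Xi> x0 s x t" and u: "same_cell \<Xi> x0 s x u" for x t u
  proof -
    let ?T = "{t. same_cell \<Xi> x0 s x t}"
    have "is_interval ?T"
      unfolding is_interval_1
    proof (intro ballI allI impI CollectI)
      fix a b t assume "a \<in> ?T" "b \<in> ?T" "a \<le> t \<and> t \<le> b"
      then show "same_cell \<Xi> x0 s x t" using same_cell_convex[of \<Xi> x0 s x a b t] by simp
    qed
    then have "path_connected ?T" by (simp add: is_interval_path_connected_1)
    moreover have "continuous_on ?T (\<lambda>t. x(n := t))"
    proof (rule continuous_on_coordinatewise_then_product)
      show "continuous_on ?T (\<lambda>t. (x(n := t)) i)" for i
        by (cases "i = n") simp_all
    qed
    ultimately have "path_connected ((\<lambda>t. x(n := t)) ` ?T)"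
      by (intro path_connected_continuous_image)
    moreover have "(\<lambda>t. x(n := t)) ` ?T \<subseteq> ?C" using x by blast
    ultimately show ?thesis
      using t u path_component_of_subset unfolding path_connected_component by blast
  qed
  show ?thesis
    unfolding path_connected_component
  proof (intro ballI)
    fix p q assume "p \<in> ?C" "q \<in> ?C"
    then obtain x t y u where p: "x \<in> A" "p = x(n := t)" "same_cell \<Xi> x0 s x t"
      and q: "y \<in> A" "q = y(n := u)" "same_cell \<Xi> x0 s y u" by blast
    have 1: "path_component ?C p (x(n := m x))"
      unfolding p(2) by (rule fibre[OF p(1,3) m(2)[rule_format, OF p(1)]])
    have 2: "path_component ?C (y(n := m y)) q"
      unfolding q(2) by (rule fibre[OF q(1) m(2)[rule_format, OF q(1)] q(3)])
    show "path_component ?C p q"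
      by (rule path_component_trans[OF 1 path_component_trans[OF graph[OF p(1) q(1)] 2]])
  qed
qed

theorem path_connected_sgn_invariant_cover:
  assumes "finite F" "\<forall>f\<in>F. poly_fun n f"
  shows "\<exists>\<C>. finite \<C> \<and> \<Union>\<C> = Rn n \<and> (\<forall>C\<in>\<C>. path_connected C \<and> sgn_invariant C F)"
  using assms
proof (induction n arbitrary: F)
  case 0
  have R0: "Rn 0 = {\<lambda>_. 0}" by (auto simp: Rn_def)
  then have "sgn_invariant (Rn 0) F" by (simp add: sgn_invariant_def)
  moreover have "path_connected (Rn 0)" unfolding R0 by simp
  ultimately show ?case by (intro exI[of _ "{Rn 0}"]) simp
next
  case (Suc n)
  obtain G P where G: "finite G" "\<forall>g\<in>G. poly_fun n g"
    and P: "\<forall>f\<in>F. \<forall>x t. f (x(n := t)) = poly (P f x) t"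
    and diag: "\<forall>A. sgn_invariant A G \<longrightarrow> (\<exists>\<Xi>. sign_diagram A (P ` F) \<Xi>)"
    using cylindrical_projection[OF Suc.prems] by (elim exE conjE)
  obtain \<C> where \<C>: "finite \<C>" "\<Union>\<C> = Rn n" "\<forall>C\<in>\<C>. path_connected C \<and> sgn_invariant C G"
    using Suc.IH[OF G] by (elim exE conjE)
  have "\<forall>A\<in>\<C>. \<exists>\<Xi>. sign_diagram A (P ` F) \<Xi>" using \<C>(3) diag by blast
  from bchoice[OF this] obtain \<Xi> where \<Xi>: "\<forall>A\<in>\<C>. sign_diagram A (P ` F) (\<Xi> A)" by (rule exE)
  define X where "X A = {z\<in>Rn (Suc n). z(n := 0) \<in> A}" for A
  \<comment> \<open>Setting coordinate \<open>n\<close> to 0 is the projection to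
    \<open>Rn n\<close>. Writing a cell as a sign class lets \<open>finite_sgn_classes\<close> count
    the cells; \<open>cell_eq\<close> recovers the description as part of a cylinder.\<close>
  define cell where "cell A y = {z\<in>X A. \<forall>\<xi>\<in>\<Xi> A. sgn (z n - \<xi> (z(n := 0))) = sgn (y n - \<xi> (y(n := 0)))}" for A y
  have cell_eq: "cell A y = {z. \<exists>x\<in>A. \<exists>t. z = x(n := t) \<and> same_cell (\<Xi> A) (y(n := 0)) (y n) x t}"
    if A: "A \<in> \<C>" for A y
  proof (intro equalityI subsetI)
    fix z assume "z \<in> cell A y"
    then have "z(n := 0) \<in> A" "same_cell (\<Xi> A) (y(n := 0)) (y n) (z(n := 0)) (z n)"
      by (simp_all add: cell_def X_def same_cell_def)
    then show "z \<in> {z. \<exists>x\<in>A. \<exists>t. z = x(n := t) \<and> same_cell (\<Xi> A) (y(n := 0)) (y n) x t}"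
      by (intro CollectI bexI[of _ "z(n := 0)"] exI[of _ "z n"]) simp_all
  next
    fix z assume "z \<in> {z. \<exists>x\<in>A. \<exists>t. z = x(n := t) \<and> same_cell (\<Xi> A) (y(n := 0)) (y n) x t}"
    then obtain x t where x: "x \<in> A" "z = x(n := t)" "same_cell (\<Xi> A) (y(n := 0)) (y n) x t" by blast
    have xR: "x \<in> Rn n" using A x(1) \<C>(2) by blast
    then have "x(n := 0) = x" by (auto simp: Rn_def)
    then show "z \<in> cell A y" using x Rn_upd[OF xR] by (simp add: cell_def X_def same_cell_def)
  qed
  let ?\<D> = "\<Union>A\<in>\<C>. cell A ` X A"
  have "finite ?\<D>"
  proof (intro finite_UN_I \<C>(1))
    fix A assume A: "A \<in> \<C>"
    have "finite (\<Xi> A)" using sign_diagramD(1) \<Xi> A by (auto simp: ordered_sections_def)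
    then show "finite (cell A ` X A)"
      unfolding cell_def by (rule finite_sgn_classes[of _ _ "\<lambda>\<xi> z. z n - \<xi> (z(n := 0))"])
  qed
  moreover have "\<Union>?\<D> = Rn (Suc n)"
  proof
    show "\<Union>?\<D> \<subseteq> Rn (Suc n)" by (auto simp: cell_def X_def)
    show "Rn (Suc n) \<subseteq> \<Union>?\<D>"
    proof
      fix z assume z: "z \<in> Rn (Suc n)"
      then have "z(n := 0) \<in> \<Union>\<C>" using \<C>(2) Rn_upd_0 by simp
      then obtain A where A: "A \<in> \<C>" "z(n := 0) \<in> A" by (rule UnionE)
      then have "z \<in> cell A z" "z \<in> X A" using z by (simp_all add: cell_def X_def)
      then show "z \<in> \<Union>?\<D>" using A(1) by blast
    qed
  qed
  moreover have "path_connected C \<and> sgn_invariant C F" if C_in: "C \<in> ?\<D>" for C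
  proof -
    obtain A y where A: "A \<in> \<C>" and y: "y \<in> X A" and C: "C = cell A y" using C_in by blast
    have d: "sign_diagram A (P ` F) (\<Xi> A)" using \<Xi> A by blast
    have yA: "y(n := 0) \<in> A" using y by (simp add: X_def)
    have "path_connected C"
      unfolding C cell_eq[OF A] using \<C>(3) A by (intro path_connected_cell[OF sign_diagramD(1)[OF d] _ yA]) simp
    moreover have "sgn_invariant C F"
      unfolding sgn_invariant_def
    proof (intro ballI)
      fix f z w assume f: "f \<in> F" and z: "z \<in> C" and w: "w \<in> C"
      obtain x t where x: "x \<in> A" "z = x(n := t)" "same_cell (\<Xi> A) (y(n := 0)) (y n) x t"
        using z unfolding C cell_eq[OF A] by blast
      obtain x' t' where x': "x' \<in> A" "w = x'(n := t')" "same_cell (\<Xi> A) (y(n := 0)) (y n) x' t'"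
        using w unfolding C cell_eq[OF A] by blast
      have "sgn (poly (P f x) t) = sgn (poly (P f x') t')"
        by (rule sign_diagramD(4)[OF d imageI[OF f] x(1) x'(1) same_cell_trans[OF same_cell_sym[OF x(3)] x'(3)]])
      then show "sgn (f z) = sgn (f w)" using P f x(2) x'(2) by simp
    qed
    ultimately show ?thesis by blast
  qed
  ultimately show ?case by (intro exI[of _ ?\<D>]) simp
qed

text \<open>A piece on which the polynomials describing \<open>S\<close> have constant signs lies
  inside \<open>S\<close> or misses it; the pieces inside are kept.\<close>

theorem semialgebraic_path_connected_cover:
  assumes "semialgebraic n S"
  shows "\<exists>\<C>. finite \<C> \<and> \<Union>\<C> = S \<and> (\<forall>C\<in>\<C>. path_connected C)"
proof -
  obtain F where F: "finite F" "\<forall>f\<in>F. poly_fun n f"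
      "\<forall>x\<in>Rn n. \<forall>y\<in>Rn n. (\<forall>f\<in>F. sgn (f x) = sgn (f y)) \<longrightarrow> (x \<in> S \<longleftrightarrow> y \<in> S)"
    using semialgebraic_imp_sign_determined[OF assms] by (elim exE conjE)
  obtain \<C> where \<C>: "finite \<C>" "\<Union>\<C> = Rn n" "\<forall>C\<in>\<C>. path_connected C \<and> sgn_invariant C F"
    using path_connected_sgn_invariant_cover[OF F(1,2)] by (elim exE conjE)
  have "C \<subseteq> S" if C: "C \<in> \<C>" and x: "x \<in> C" "x \<in> S" for C x
  proof
    fix y assume y: "y \<in> C"
    have "\<forall>f\<in>F. sgn (f x) = sgn (f y)"
      using \<C>(3) C x(1) y unfolding sgn_invariant_def by blast
    moreover have "x \<in> Rn n" "y \<in> Rn n" using C x(1) y \<C>(2) by blast+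
    ultimately show "y \<in> S" using F(3) x(2) by blast
  qed
  moreover have "x \<in> \<Union>\<C>" if "x \<in> S" for x
    using semialgebraic_subset[OF assms] \<C>(2) that by auto
  ultimately have "\<Union>{C\<in>\<C>. C \<subseteq> S} = S" by fast
  then show ?thesis using \<C> by (intro exI[of _ "{C\<in>\<C>. C \<subseteq> S}"]) simp
qed

section \<open>Polynomial knots\<close>

text \<open>Each component meets a member of the cover and, by maximality, contains it. As
  components are disjoint, choosing such a member is injective.\<close>

lemma finite_path_components_of:
  assumes fin: "finite \<C>" and cover: "\<Union>\<C> = topspace X"
    and conn: "\<And>C. C \<in> \<C> \<Longrightarrow> path_connectedin X C"
  shows "finite (path_components_of X)"
proof -
  have "\<exists>C\<in>\<C>. \<not> disjnt K C" if K: "K \<in> path_components_of X" for K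
  proof -
    obtain a where "a \<in> K" using nonempty_path_components_of[OF K] by blast
    moreover from this have "a \<in> \<Union>\<C>" using path_components_of_subset[OF K] cover by blast
    ultimately show ?thesis by (auto simp: disjnt_def)
  qed
  then obtain c where c: "\<And>K. K \<in> path_components_of X \<Longrightarrow> c K \<in> \<C> \<and> \<not> disjnt K (c K)"
    by metis
  have "inj_on c (path_components_of X)"
  proof (rule inj_onI)
    fix K L assume K: "K \<in> path_components_of X" and L: "L \<in> path_components_of X" and eq: "c K = c L"
    have "c K \<subseteq> K" "c K \<subseteq> L"
      using path_components_of_maximal[OF K conn] path_components_of_maximal[OF L conn] c[OF K] c[OF L] eq
      by simp_all
    moreover have "c K \<noteq> {}" using c[OF K] by auto
    ultimately have "\<not> disjnt K L" by (auto simp: disjnt_def)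
    then show "K = L"
      using pairwise_disjoint_path_components_of[of X] K L by (auto simp: pairwise_def)
  qed
  moreover have "c ` path_components_of X \<subseteq> \<C>" using c by blast
  ultimately show ?thesis using fin by (rule inj_on_finite)
qed

lemma semialgebraic_Collect_conj:
  assumes "semialgebraic n {x\<in>Rn n. P x}" "semialgebraic n {x\<in>Rn n. Q x}"
  shows "semialgebraic n {x\<in>Rn n. P x \<and> Q x}"
proof -
  have "{x\<in>Rn n. P x \<and> Q x} = {x\<in>Rn n. P x} \<inter> {x\<in>Rn n. Q x}" by blast
  then show ?thesis using sa_inter[OF assms] by simp
qed

lemma semialgebraic_Collect_not:
  assumes "semialgebraic n {x\<in>Rn n. P x}"
  shows "semialgebraic n {x\<in>Rn n. \<not> P x}"
proof -
  have "{x\<in>Rn n. \<not> P x} = Rn n - {x\<in>Rn n. P x}" by blast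
  then show ?thesis using sa_compl[OF assms] by simp
qed

lemma semialgebraic_Collect_ex:
  assumes "semialgebraic (Suc n) {x\<in>Rn (Suc n). P x}"
  shows "semialgebraic n {x\<in>Rn n. \<exists>t. P (x(n := t))}"
proof -
  have "{x\<in>Rn n. \<exists>t. x(n := t) \<in> {x\<in>Rn (Suc n). P x}} = {x\<in>Rn n. \<exists>t. P (x(n := t))}"
    using Rn_upd by blast
  then show ?thesis using semialgebraic_projection[OF assms] by simp
qed

text \<open>Decodes one coordinate block of \<open>eta\<close>: \<open>m\<close> is its offset and
  \<open>k\<close> its length.\<close>

definition block_poly :: "nat \<Rightarrow> nat \<Rightarrow> (nat \<Rightarrow> real) \<Rightarrow> real poly" where
  "block_poly m k x = (\<Sum>i<k. monom (x (m + i)) i)"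

lemma coeff_block_poly: "coeff (block_poly m k x) i = (if i < k then x (m + i) else 0)"
  by (simp add: block_poly_def coeff_sum sum.delta)

lemma degree_block_poly: "degree (block_poly m (Suc k) x) \<le> k"
  by (rule degree_le) (simp add: coeff_block_poly)

lemma block_poly_coeffs:
  assumes "degree p < k" "\<And>i. i < k \<Longrightarrow> x (m + i) = coeff p i"
  shows "block_poly m k x = p"
  by (rule poly_eqI) (use assms in \<open>simp add: coeff_block_poly coeff_eq_0\<close>)

text \<open>Quantified variables are stored in coordinates after the blocks and must not disturb the
  polynomials.\<close>

lemma block_poly_upd: "m + k \<le> j \<Longrightarrow> block_poly m k (x(j := t)) = block_poly m k x"
  by (rule poly_eqI) (simp add: coeff_block_poly)

lemma pderiv_sum: "pderiv (\<Sum>i\<in>I. p i) = (\<Sum>i\<in>I. pderiv (p i))"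
  by (induction I rule: infinite_finite_induct) (simp_all add: pderiv_add)

lemma poly_fun_block_poly:
  assumes "m + k \<le> n" "j < n"
  shows "poly_fun n (\<lambda>x. poly (block_poly m k x) (x j))"
    "poly_fun n (\<lambda>x. poly (pderiv (block_poly m k x)) (x j))"
proof -
  have "poly_fun n (\<lambda>x. \<Sum>i<k. x (m + i) * x j ^ i)"
    using assms by (intro poly_fun_sum pf_mult poly_fun_power pf_var) simp_all
  then show "poly_fun n (\<lambda>x. poly (block_poly m k x) (x j))"
    by (simp add: block_poly_def poly_sum poly_monom)
  \<comment> \<open>For \<open>i = 0\<close> the factor \<open>of_nat i\<close> is 0, so the
    truncated exponent does no harm.\<close>
  have "poly_fun n (\<lambda>x. \<Sum>i<k. (of_nat i * x (m + i)) * x j ^ (i - 1))"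
    using assms by (intro poly_fun_sum pf_mult poly_fun_power pf_var pf_const) simp_all
  then show "poly_fun n (\<lambda>x. poly (pderiv (block_poly m k x)) (x j))"
    by (simp add: block_poly_def pderiv_sum pderiv_monom poly_sum poly_monom)
qed

definition eta_inv :: "nat \<Rightarrow> (nat \<Rightarrow> real) \<Rightarrow> real poly \<times> real poly \<times> real poly" where
  "eta_inv d x = (block_poly 0 (d - 1) x, block_poly (d - 1) d x, block_poly (2 * d - 1) (d + 1) x)"

lemma eta_inv_in_A_d:
  assumes "d \<ge> 2"
  shows "eta_inv d x \<in> A_d d"
proof -
  have "degree (block_poly 0 (d - 1) x) \<le> d - 2" "degree (block_poly (d - 1) d x) \<le> d - 1"
    "degree (block_poly (2 * d - 1) (d + 1) x) \<le> d"
    using assms degree_block_poly[of 0 "d - 2" x] degree_block_poly[of "d - 1" "d - 1" x]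
      degree_block_poly[of "2 * d - 1" d x]
    by (simp_all add: numeral_2_eq_2 Suc_diff_Suc)
  then show ?thesis by (simp add: eta_inv_def A_d_def)
qed

lemma eta_eta_inv:
  assumes "d \<ge> 2" "x \<in> Rn (3 * d)"
  shows "eta d (eta_inv d x) = x"
proof
  fix i
  have "i \<ge> 3 * d \<Longrightarrow> x i = 0" using assms(2) by (simp add: Rn_def)
  then show "eta d (eta_inv d x) i = x i"
    using assms(1) by (auto simp: eta_def eta_inv_def coeff_block_poly)
qed

lemma eta_inv_eta:
  assumes "d \<ge> 2" "\<phi> \<in> A_d d"
  shows "eta_inv d (eta d \<phi>) = \<phi>"
proof -
  obtain f g h where \<phi>: "\<phi> = (f, g, h)" by (cases \<phi>)
  have "block_poly 0 (d - 1) (eta d \<phi>) = f"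
    by (rule block_poly_coeffs) (use assms \<phi> in \<open>auto simp: A_d_def eta_def\<close>)
  moreover have "block_poly (d - 1) d (eta d \<phi>) = g"
    by (rule block_poly_coeffs) (use assms \<phi> in \<open>auto simp: A_d_def eta_def\<close>)
  moreover have "block_poly (2 * d - 1) (d + 1) (eta d \<phi>) = h"
    by (rule block_poly_coeffs) (use assms \<phi> in \<open>auto simp: A_d_def eta_def\<close>)
  ultimately show ?thesis by (simp add: eta_inv_def \<phi>)
qed

lemma eta_in_Rn: "eta d \<phi> \<in> Rn (3 * d)"
  by (cases \<phi>) (auto simp: Rn_def eta_def)

lemma eta_image_O_d:
  assumes "d \<ge> 2"
  shows "eta d ` O_d d = {x\<in>Rn (3 * d). polynomial_knot (eta_inv d x)}"
proof (intro equalityI subsetI)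
  fix x assume "x \<in> eta d ` O_d d"
  then obtain \<phi> where "\<phi> \<in> A_d d" "polynomial_knot \<phi>" "x = eta d \<phi>" by (auto simp: O_d_def)
  then show "x \<in> {x\<in>Rn (3 * d). polynomial_knot (eta_inv d x)}"
    using eta_inv_eta[OF assms] eta_in_Rn by simp
next
  fix x assume "x \<in> {x\<in>Rn (3 * d). polynomial_knot (eta_inv d x)}"
  then have x: "x \<in> Rn (3 * d)" and "polynomial_knot (eta_inv d x)" by simp_all
  then have "eta_inv d x \<in> O_d d" using eta_inv_in_A_d[OF assms] by (simp add: O_d_def)
  then show "x \<in> eta d ` O_d d" using eta_eta_inv[OF assms x] by (metis image_eqI)
qed

text \<open>Universal quantifiers become negated existential ones and equalities become vanishing
  differences, the form accepted by \<open>semialgebraic_Collect_ex\<close> and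
  \<open>sa_zero\<close>.\<close>

lemma polynomial_knot_iff:
  "polynomial_knot (f, g, h) \<longleftrightarrow>
    \<not> (\<exists>s t. (poly f s - poly f t = 0 \<and> poly g s - poly g t = 0 \<and> poly h s - poly h t = 0) \<and> \<not> s - t = 0) \<and>
    \<not> (\<exists>t. poly (pderiv f) t = 0 \<and> poly (pderiv g) t = 0 \<and> poly (pderiv h) t = 0)"
  unfolding polynomial_knot_def inj_def by auto

lemma semialgebraic_eta_O_d:
  assumes "d \<ge> 2"
  shows "semialgebraic (3 * d) (eta d ` O_d d)"
proof -
  define N where "N = 3 * d"
  define f where "f = block_poly 0 (d - 1)"
  define g where "g = block_poly (d - 1) d"
  define h where "h = block_poly (2 * d - 1) (d + 1)"
  have upd: "f (x(j := t)) = f x" "g (x(j := t)) = g x" "h (x(j := t)) = h x" if "N \<le> j" for x j t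
    unfolding f_def g_def h_def by (rule block_poly_upd, use assms that in \<open>simp add: N_def\<close>)+
  have pf: "poly_fun M (\<lambda>x. poly (p x) (x j))" "poly_fun M (\<lambda>x. poly (pderiv (p x)) (x j))"
    if "N \<le> M" "j < M" "p \<in> {f, g, h}" for M j p
    using that(3) unfolding f_def g_def h_def insert_iff empty_iff
    by (elim disjE FalseE; hypsubst; intro poly_fun_block_poly; use assms that in \<open>simp add: N_def\<close>)+
  have diff: "semialgebraic (Suc (Suc N)) {x\<in>Rn (Suc (Suc N)). poly (p x) (x N) - poly (p x) (x (Suc N)) = 0}"
    if "p \<in> {f, g, h}" for p
    using that by (intro sa_zero poly_fun_diff pf) simp_all
  have "semialgebraic (Suc (Suc N)) {x\<in>Rn (Suc (Suc N)). x N - x (Suc N) = 0}"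
    by (intro sa_zero poly_fun_diff pf_var) simp_all
  then have "semialgebraic (Suc (Suc N)) {x\<in>Rn (Suc (Suc N)).
      (poly (f x) (x N) - poly (f x) (x (Suc N)) = 0 \<and>
       poly (g x) (x N) - poly (g x) (x (Suc N)) = 0 \<and>
       poly (h x) (x N) - poly (h x) (x (Suc N)) = 0) \<and> \<not> x N - x (Suc N) = 0}"
    using diff by (intro semialgebraic_Collect_conj semialgebraic_Collect_not) simp_all
  \<comment> \<open>Coordinate \<open>Suc N\<close> is eliminated first and becomes
    \<open>t\<close>; coordinate \<open>N\<close> becomes \<open>s\<close>. By \<open>upd\<close>
    neither affects the three polynomials.\<close>
  from semialgebraic_Collect_ex[OF semialgebraic_Collect_ex[OF this]]
  have 1: "semialgebraic N {x\<in>Rn N. \<exists>s t.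
      (poly (f x) s - poly (f x) t = 0 \<and> poly (g x) s - poly (g x) t = 0 \<and>
       poly (h x) s - poly (h x) t = 0) \<and> \<not> s - t = 0}"
    by (simp add: upd)
  have deriv: "semialgebraic (Suc N) {x\<in>Rn (Suc N). poly (pderiv (p x)) (x N) = 0}"
    if "p \<in> {f, g, h}" for p
    using that by (intro sa_zero pf) simp_all
  have "semialgebraic (Suc N) {x\<in>Rn (Suc N). poly (pderiv (f x)) (x N) = 0 \<and>
      poly (pderiv (g x)) (x N) = 0 \<and> poly (pderiv (h x)) (x N) = 0}"
    using deriv by (intro semialgebraic_Collect_conj) simp_all
  from semialgebraic_Collect_ex[OF this]
  have 2: "semialgebraic N {x\<in>Rn N. \<exists>t. poly (pderiv (f x)) t = 0 \<and>
      poly (pderiv (g x)) t = 0 \<and> poly (pderiv (h x)) t = 0}"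
    by (simp add: upd)
  have "eta d ` O_d d = {x\<in>Rn N. polynomial_knot (f x, g x, h x)}"
    using eta_image_O_d[OF assms] by (simp add: N_def eta_inv_def f_def g_def h_def)
  then show ?thesis
    using semialgebraic_Collect_conj[OF semialgebraic_Collect_not[OF 1] semialgebraic_Collect_not[OF 2]]
    unfolding polynomial_knot_iff N_def by simp
qed

text \<open>The topology is pulled back along \<open>eta\<close>, so continuity of
  \<open>eta_inv d\<close> reduces to that of \<open>eta d \<circ> eta_inv d\<close>, which is the
  identity on \<open>C\<close>.\<close>

lemma continuous_map_eta_inv:
  assumes "d \<ge> 2" "C \<subseteq> eta d ` O_d d"
  shows "continuous_map (top_of_set C) (subtopology (A_d_topology d) (O_d d)) (eta_inv d)"
proof -
  have C: "x \<in> Rn (3 * d)" "polynomial_knot (eta_inv d x)" if "x \<in> C" for x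
    using assms(2) that unfolding eta_image_O_d[OF assms(1)] by auto
  have "continuous_map (top_of_set C) (subtopology euclidean (Rn (3 * d))) (eta d \<circ> eta_inv d)"
  proof (rule continuous_map_eq)
    show "continuous_map (top_of_set C) (subtopology euclidean (Rn (3 * d))) id"
      using C(1) by (auto simp: continuous_map_in_subtopology)
    show "id x = (eta d \<circ> eta_inv d) x" if "x \<in> topspace (top_of_set C)" for x
      using eta_eta_inv[OF assms(1) C(1)] that by simp
  qed
  then have "continuous_map (top_of_set C) (A_d_topology d) (eta_inv d)"
    unfolding A_d_topology_def
    by (rule continuous_map_pullback') (use eta_inv_in_A_d[OF assms(1)] in auto)
  then show ?thesis
    using C(2) eta_inv_in_A_d[OF assms(1)] by (auto simp: continuous_map_in_subtopology O_d_def)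
qed

text \<open>\<open>eta_inv d\<close> carries the finite cover of the semialgebraic image by
  path-connected pieces continuously back to the knots.\<close>

lemma finite_path_components_O_d:
  assumes "d \<ge> 2"
  shows "finite (path_components_of (subtopology (A_d_topology d) (O_d d)))"
proof -
  let ?X = "subtopology (A_d_topology d) (O_d d)"
  obtain \<C> where \<C>: "finite \<C>" "\<Union>\<C> = eta d ` O_d d" "\<forall>C\<in>\<C>. path_connected C"
    using semialgebraic_path_connected_cover[OF semialgebraic_eta_O_d[OF assms]] by (elim exE conjE)
  show ?thesis
  proof (rule finite_path_components_of)
    show "finite ((\<lambda>C. eta_inv d ` C) ` \<C>)" using \<C>(1) by simp
    have "\<Union>((\<lambda>C. eta_inv d ` C) ` \<C>) = eta_inv d ` eta d ` O_d d"
      unfolding \<C>(2)[symmetric] by blast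
    also have "\<dots> = (\<lambda>\<phi>. \<phi>) ` O_d d"
      unfolding image_image by (rule image_cong[OF refl eta_inv_eta[OF assms]]) (simp add: O_d_def)
    also have "\<dots> = topspace ?X"
      using eta_in_Rn by (auto simp: A_d_topology_def topspace_pullback_topology O_d_def)
    finally show "\<Union>((\<lambda>C. eta_inv d ` C) ` \<C>) = topspace ?X" .
    fix K assume "K \<in> (\<lambda>C. eta_inv d ` C) ` \<C>"
    then obtain C where C: "C \<in> \<C>" "K = eta_inv d ` C" by blast
    have "continuous_map (top_of_set C) ?X (eta_inv d)"
      using C(1) \<C>(2) by (intro continuous_map_eta_inv[OF assms]) blast
    moreover have "path_connectedin (top_of_set C) C"
      using C(1) \<C>(3) by (simp add: path_connectedin_subtopology)
    ultimately show "path_connectedin ?X K"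
      unfolding C(2) by (rule path_connectedin_continuous_map_image)
  qed
qed

theorem mainTheorem9:
  fixes d :: nat
  assumes "d \<ge> 2"
  shows "semialgebraic (3 * d) (eta d ` O_d d)
         \<and> finite (path_components_of (subtopology (A_d_topology d) (O_d d)))"
  using semialgebraic_eta_O_d[OF assms] finite_path_components_O_d[OF assms] by (rule conjI)

end
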